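(* The expectation $\mathbb{E}(R_{n}^{(k)})$ is, for $0 \le k \le n$ and $n \ge 1$, given by $$\mathbb{E}(R_{n}^{(k)}) = \sum_{j=1}^{k} \frac{j \, k^{\underline{j}}}{n^{j}}.$$ Depending on the growth of $k=k(n)$, $\mathbb{E}(R_{n}^{(k)})$ has the following asymptotic behavior as $n\to\infty$: $$\mathbb{E}(R_{n}^{(k)}) \sim \begin{cases} \frac{k}{n}, & \text{for } k=o(n),\\[1ex] \frac{\alpha}{(1-\alpha)^{2}}, & \text{for } k \sim \alpha n, \text{ with } 0 < \alpha < 1,\\[1ex] \frac{n^{2}}{d^{2}}, & \text{for } k=n-d, \text{ with } d = \omega(\sqrt{n}) \text{ and } d = o(n),\\[1ex] \kappa n, & \text{for } k=n-d, \text{ with } d \sim c \sqrt{n} \text{ and } c > 0, \text{ where } \kappa = 1-c e^{\frac{c^{2}}{2}} \int_{c}^{\infty} e^{-\frac{t^{2}}{2}} dt,\\[1ex] n - \sqrt{\frac{\pi}{2}}\, d \sqrt{n}, & \text{for } k=n-d, \text{ with } d = o(\sqrt{n}). \end{cases}$$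
   Context: A rooted labeled tree of size $n$ is a tree with vertex set $[n]=\{1,\dots,n\}$ together with a distinguished root vertex; there are $n^{n-1}$ of them. For $0\le k\le n$, after uncovering $k$ vertices (those with labels in $[k]$), the root cluster is the connected component containing the root in the subgraph induced by the uncovered vertices; its size is taken to be $0$ if the root is not uncovered. $R_n^{(k)}$ denotes the size of the root cluster of a uniformly random rooted labeled tree of size $n$ with $k$ uncovered vertices. $x^{\underline{j}} = x(x-1)\cdots(x-j+1)$ is the falling factorial. $a_n\sim b_n$ means $a_n=(1+o(1))b_n$, and $d=\omega(g)$ means $d/g\to\infty$. *)

theory Defs
  imports "HOL-Probability.Probability" "HOL-Library.Landau_Symbols"
begin

text \<open>
  Finite simple undirected graphs are given by a vertex set and a set of two-element edges.
  The predicate \<open>tree\<close> of the AFP entry Graph\_Theory is not used: it forbids directed cycles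
  only, so it excludes symmetric digraphs with an edge and admits several
  orientations of the same undirected tree.
\<close>

definition simple_graph :: "'a set \<Rightarrow> 'a set set \<Rightarrow> bool" where
  "simple_graph V E \<longleftrightarrow> finite V \<and> (\<forall>e\<in>E. e \<subseteq> V \<and> card e = 2)"

definition adjacency :: "'a set set \<Rightarrow> ('a \<times> 'a) set" where
  "adjacency E = {(u, v). {u, v} \<in> E}"

definition component_of_vertex :: "'a set \<Rightarrow> 'a set set \<Rightarrow> 'a \<Rightarrow> 'a set" where
  "component_of_vertex V E v = {u \<in> V. (v, u) \<in> (adjacency E)\<^sup>*}"

definition connected_graph :: "'a set \<Rightarrow> 'a set set \<Rightarrow> bool" where
  "connected_graph V E \<longleftrightarrow> V \<noteq> {} \<and> (\<forall>u\<in>V. \<forall>v\<in>V. (u, v) \<in> (adjacency E)\<^sup>*)"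

definition graph_cycle :: "'a set set \<Rightarrow> 'a list \<Rightarrow> bool" where
  "graph_cycle E p \<longleftrightarrow> length p \<ge> 3 \<and> distinct p \<and>
     (\<forall>i < length p. {p ! i, p ! (Suc i mod length p)} \<in> E)"

definition tree_graph :: "'a set \<Rightarrow> 'a set set \<Rightarrow> bool" where
  "tree_graph V E \<longleftrightarrow> simple_graph V E \<and> connected_graph V E \<and> (\<nexists>p. graph_cycle E p)"

definition induced_edges :: "'a set set \<Rightarrow> 'a set \<Rightarrow> 'a set set" where
  "induced_edges E S = {e \<in> E. e \<subseteq> S}"

definition rooted_labeled_trees :: "nat \<Rightarrow> (nat set set \<times> nat) set" where
  "rooted_labeled_trees n = {(E, r). tree_graph {1..n} E \<and> r \<in> {1..n}}"

definition root_cluster_size :: "nat \<Rightarrow> nat set set \<times> nat \<Rightarrow> nat" where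
  "root_cluster_size k = (\<lambda>(E, r).
     if r \<in> {1..k} then card (component_of_vertex {1..k} (induced_edges E {1..k}) r) else 0)"

text \<open>The law of $R_n^{(k)}$, meaningful for $n \geq 1$ (there is no rooted tree of size $0$).\<close>

definition root_cluster_pmf :: "nat \<Rightarrow> nat \<Rightarrow> nat pmf" where
  "root_cluster_pmf n k = map_pmf (root_cluster_size k) (pmf_of_set (rooted_labeled_trees n))"

definition expected_root_cluster :: "nat \<Rightarrow> nat \<Rightarrow> real" where
  "expected_root_cluster n k = measure_pmf.expectation (root_cluster_pmf n k) real"

definition falling_factorial :: "'a::comm_ring_1 \<Rightarrow> nat \<Rightarrow> 'a" where
  "falling_factorial x j = (\<Prod>i<j. x - of_nat i)"

end

theory Submission
  imports Defs
begin

text \<open>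
  Write \<open>E\<close> for the expected size of the root cluster.

  \<^bold>\<open>The exact formula.\<close> A vertex belongs to the root cluster iff the path from it to the root uses
  only labels in \<open>[k]\<close>. Hence \<open>E\<close> is the sum, over all simple paths in \<open>[k]\<close>, of the proportion of
  rooted trees whose root is the end of the path and which contain the path. Erasing the edges of a
  path with \<open>j\<close> vertices turns such a tree into a forest rooted at these \<open>j\<close> vertices, and there are
  \<open>j n ^ (n - j - 1)\<close> such forests (\<open>card_forest_maps\<close>, proved by peeling off the children of the
  roots). The case \<open>j = 1\<close> is Cayley's formula and gives the denominator; the number of paths is the
  falling factorial of \<open>k\<close>. Trees given by edge sets are identified with acyclic parent maps
  (\<open>parent_edges_bij\<close>), for which all of this is bookkeeping.

  \<^bold>\<open>Gaps beyond the square root.\<close> Put \<open>a\<^sub>j\<close> for the falling factorial of \<open>k\<close> over \<open>n ^ j\<close>, and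
  \<open>d = n - k\<close>. Since \<open>a\<^sub>j\<^sub>+\<^sub>1 = a\<^sub>j (k - j) / n\<close>, summation by parts yields linear relations between the
  moments \<open>\<Sum> j ^ i a\<^sub>j\<close>. With \<open>Q\<close>, \<open>E\<close> and \<open>M\<close> for the moments of order 0, 1 and 2 they say
  \<open>E = n - d Q\<close> and \<open>E (d\<^sup>2 + n) = k n - d M\<close>, and also that \<open>M \<le> 2 k n\<^sup>2 / d\<^sup>3\<close>. So \<open>E\<close> equals
  \<open>k n / d\<^sup>2\<close> up to a relative error of order \<open>n / d\<^sup>2\<close> (\<open>draw_moment_1_ratio\<close>). This settles
  the regimes \<open>k = o(n)\<close>, \<open>k \<sim> \<alpha> n\<close> and \<open>sqrt n \<lless> d \<lless> n\<close> at once.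

  \<^bold>\<open>Gaps up to the square root.\<close> If \<open>d / sqrt n\<close> tends to \<open>c\<close>, then \<open>a\<^sub>j\<close> at \<open>j = t sqrt n\<close> tends to
  \<open>exp (- c t - t\<^sup>2 / 2)\<close>, and by dominated convergence \<open>Q / sqrt n\<close> tends to the integral \<open>I\<close> of this
  function over \<open>t \<ge> 0\<close>. From \<open>E = n - d Q\<close> it follows that \<open>E / n\<close> tends to \<open>1 - c I\<close>
  (\<open>draw_moment_1_critical\<close>). The substitution \<open>t \<mapsto> t - c\<close> turns the limit into \<open>\<kappa>\<close>, which is positive
  because \<open>I < 1 / c\<close>. For \<open>c = 0\<close> the limit is 1, and the correction \<open>d sqrt n\<close> in the last regime is
  itself \<open>o(n)\<close>.
\<close>

section \<open>Rooted forests as parent maps\<close>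

text \<open>
  Iterating the parent map \<open>f\<close> from a vertex eventually hits the root set. An inductive
  predicate serves better than a statement about iterates, because all inductions below follow the
  walk one parent at a time.
\<close>

inductive leads_to :: "('a \<Rightarrow> 'a) \<Rightarrow> 'a set \<Rightarrow> 'a \<Rightarrow> bool" for f S where
  root: "v \<in> S \<Longrightarrow> leads_to f S v"
| step: "leads_to f S (f v) \<Longrightarrow> leads_to f S v"

text \<open>
  A forest on \<open>M \<union> S\<close> in which every component contains exactly one vertex of the root set \<open>S\<close>
  is the same thing as a choice of parent for every non-root such that all walks end in \<open>S\<close>.
  Extensionality outside \<open>M\<close> makes the maps countable objects.
\<close>

definition forest_maps :: "'a set \<Rightarrow> 'a set \<Rightarrow> ('a \<Rightarrow> 'a) set" where
  "forest_maps M S = {f \<in> M \<rightarrow>\<^sub>E M \<union> S. \<forall>v\<in>M. leads_to f S v}"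

lemma finite_forest_maps:
  assumes "finite M" "finite S"
  shows "finite (forest_maps M S)"
proof (rule finite_subset)
  show "forest_maps M S \<subseteq> M \<rightarrow>\<^sub>E M \<union> S" by (auto simp: forest_maps_def)
  show "finite (M \<rightarrow>\<^sub>E M \<union> S)" using assms by (intro finite_PiE) auto
qed

lemma forest_maps_no_roots:
  assumes "M \<noteq> {}"
  shows "forest_maps M {} = {}"
proof -
  have "\<not> leads_to f {} v" for f and v :: 'a
  proof
    assume "leads_to f {} v"
    then show False by induction auto
  qed
  with assms show ?thesis by (auto simp: forest_maps_def)
qed

lemma forest_maps_no_nonroots: "forest_maps {} S = {\<lambda>_. undefined}"
  by (auto simp: forest_maps_def)

text \<open>
  Transfer of termination between two parent maps: it suffices that the maps agree as long as the
  walk stays in \<open>M\<close>, except where termination of the second walk is already known.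
\<close>

lemma leads_to_cong:
  assumes "leads_to f S v" "v \<in> M"
    and root: "\<And>u. u \<in> M \<Longrightarrow> u \<in> S \<Longrightarrow> leads_to g T u"
    and step: "\<And>u. u \<in> M \<Longrightarrow> u \<notin> S \<Longrightarrow> leads_to g T u \<or> (f u \<in> M \<and> g u = f u)"
  shows "leads_to g T v"
  using assms(1,2)
proof induction
  case (root v)
  then show ?case using assms(3) by blast
next
  case (step v)
  then show ?case using assms(3)[of v] assms(4)[of v] leads_to.step[of g T v] by (cases "v \<in> S") auto
qed

text \<open>
  Let \<open>B\<close> be the set of children of the roots. Cutting the edges between \<open>B\<close> and \<open>S\<close> leaves an
  arbitrary map from \<open>B\<close> to \<open>S\<close> and a forest on the remaining vertices whose roots are \<open>B\<close>.
\<close>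

lemma forest_maps_first_layer:
  assumes "M \<inter> S = {}" "B \<subseteq> M"
  shows "bij_betw (\<lambda>f. (restrict f B, restrict f (M - B)))
           {f \<in> forest_maps M S. {v\<in>M. f v \<in> S} = B}
           ((B \<rightarrow>\<^sub>E S) \<times> forest_maps (M - B) B)"
proof (rule bij_betw_byWitness[where f' = "\<lambda>(g, h) v. if v \<in> B then g v else h v"], goal_cases)
  case 1
  show ?case using assms
    by (auto simp: forest_maps_def fun_eq_iff PiE_def extensional_def)
next
  case 2
  show ?case using assms by (auto simp: forest_maps_def fun_eq_iff PiE_def extensional_def restrict_def)
next
  case 3
  show ?case
  proof (rule image_subsetI)
    fix f assume "f \<in> {f \<in> forest_maps M S. {v\<in>M. f v \<in> S} = B}"
    then have f: "f \<in> forest_maps M S" and B: "B = {v\<in>M. f v \<in> S}" by auto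
    let ?B = "{v\<in>M. f v \<in> S}"
    have "restrict f ?B \<in> ?B \<rightarrow>\<^sub>E S" by auto
    moreover have fM: "f v \<in> M \<union> S" if "v \<in> M" for v using f that by (auto simp: forest_maps_def)
    have "leads_to (restrict f (M - ?B)) ?B v" if "v \<in> M" for v
    proof (rule leads_to_cong[where M = M])
      show "leads_to f S v" using f that by (auto simp: forest_maps_def)
      show "v \<in> M" by fact
      show "leads_to (restrict f (M - ?B)) ?B u" if "u \<in> M" "u \<in> S" for u
        using that assms by auto
      show "leads_to (restrict f (M - ?B)) ?B u \<or> (f u \<in> M \<and> restrict f (M - ?B) u = f u)"
        if "u \<in> M" for u
        using that fM by (cases "u \<in> ?B") (auto intro: leads_to.root)
    qed
    then have "restrict f (M - ?B) \<in> forest_maps (M - ?B) ?B"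
      using fM by (auto simp: forest_maps_def)
    ultimately show "(restrict f B, restrict f (M - B)) \<in> (B \<rightarrow>\<^sub>E S) \<times> forest_maps (M - B) B"
      unfolding B by blast
  qed
next
  case 4
  show ?case
  proof (rule image_subsetI)
    fix x assume "x \<in> (B \<rightarrow>\<^sub>E S) \<times> forest_maps (M - B) B"
    then obtain g h where x: "x = (g, h)" and g: "g \<in> B \<rightarrow>\<^sub>E S" and h: "h \<in> forest_maps (M - B) B"
      by blast
    let ?f = "\<lambda>v. if v \<in> B then g v else h v"
    have hM: "h v \<in> M" if "v \<in> M" "v \<notin> B" for v
      using h that assms by (auto simp: forest_maps_def)
    have gS: "g v \<in> S" if "v \<in> B" for v using g that by auto
    have B: "leads_to ?f S u" if "u \<in> B" for u
      by (rule leads_to.step, rule leads_to.root) (simp add: that gS)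
    have lt: "leads_to ?f S v" if "v \<in> M" for v
    proof (cases "v \<in> B")
      case False
      show ?thesis
      proof (rule leads_to_cong[where M = M])
        show "leads_to h B v" using h that False by (auto simp: forest_maps_def)
      qed (use B hM that in auto)
    qed (use B in auto)
    have "?f \<in> M \<rightarrow>\<^sub>E M \<union> S"
      using g h hM assms(2) by (fastforce simp: forest_maps_def PiE_def extensional_def)
    moreover have "{v\<in>M. ?f v \<in> S} = B" using gS hM assms by auto
    ultimately show "(case x of (g, h) \<Rightarrow> \<lambda>v. if v \<in> B then g v else h v)
        \<in> {f \<in> forest_maps M S. {v\<in>M. f v \<in> S} = B}"
      using lt by (simp add: forest_maps_def x)
  qed
qed

lemma card_forest_maps_layers:
  assumes "finite M" "finite S" "M \<inter> S = {}"
  shows "card (forest_maps M S) = (\<Sum>B\<in>Pow M. card S ^ card B * card (forest_maps (M - B) B))"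
proof -
  have "card (forest_maps M S) = (\<Sum>B\<in>Pow M. card {f \<in> forest_maps M S. {v\<in>M. f v \<in> S} = B})"
    using sum.group[of "forest_maps M S" "Pow M" "\<lambda>f. {v\<in>M. f v \<in> S}" "\<lambda>_. 1::nat"] assms
    by (simp add: finite_forest_maps image_subset_iff)
  also have "\<dots> = (\<Sum>B\<in>Pow M. card S ^ card B * card (forest_maps (M - B) B))"
  proof (rule sum.cong)
    fix B assume "B \<in> Pow M"
    then have B: "B \<subseteq> M" "finite B" using assms finite_subset by auto
    show "card {f \<in> forest_maps M S. {v\<in>M. f v \<in> S} = B} = card S ^ card B * card (forest_maps (M - B) B)"
      using bij_betw_same_card[OF forest_maps_first_layer[OF assms(3) B(1)]] B(2)
      by (simp add: card_cartesian_product card_PiE)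
  qed simp
  finally show ?thesis .
qed

lemma sum_Pow_card:
  fixes g :: "nat \<Rightarrow> nat"
  assumes "finite M"
  shows "(\<Sum>B\<in>Pow M. g (card B)) = (\<Sum>i\<le>card M. (card M choose i) * g i)"
proof -
  have "(\<Sum>B\<in>Pow M. g (card B)) = (\<Sum>i\<le>card M. \<Sum>B\<in>{B\<in>Pow M. card B = i}. g (card B))"
    using assms by (intro sum.group[symmetric]) (auto intro: card_mono)
  also have "\<dots> = (\<Sum>i\<le>card M. (card M choose i) * g i)"
    using assms n_subsets[OF assms] by (intro sum.cong) (auto simp: Pow_def)
  finally show ?thesis .
qed

text \<open>
  The factor \<open>i\<close> is absorbed by \<open>i \<cdot> (m+1 choose i) = (m+1) \<cdot> (m choose i-1)\<close>, after which the binomial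
  theorem applies.
\<close>

lemma weighted_binomial:
  fixes s m :: nat
  shows "(\<Sum>i\<le>Suc m. (Suc m choose i) * (s ^ i * (i * t ^ (Suc m - i)))) = Suc m * s * (s + t) ^ m"
proof -
  have "(Suc m choose Suc i) * (s ^ Suc i * (Suc i * t ^ (Suc m - Suc i)))
          = Suc m * s * ((m choose i) * s ^ i * t ^ (m - i))" for i
  proof -
    have "(Suc m choose Suc i) * (s ^ Suc i * (Suc i * t ^ (Suc m - Suc i)))
      = (Suc i * (Suc m choose Suc i)) * (s ^ Suc i * t ^ (m - i))" by (simp only: ac_simps diff_Suc_Suc)
    also have "\<dots> = Suc m * s * ((m choose i) * s ^ i * t ^ (m - i))"
      by (simp only: Suc_times_binomial power_Suc ac_simps)
    finally show ?thesis .
  qed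
  then have "(\<Sum>i\<le>Suc m. (Suc m choose i) * (s ^ i * (i * t ^ (Suc m - i)))) =
      (\<Sum>i\<le>m. Suc m * s * ((m choose i) * s ^ i * t ^ (m - i)))"
    by (subst sum.atMost_Suc_shift) (simp only: mult_0 mult_0_right add_0)
  also have "\<dots> = Suc m * s * (s + t) ^ m"
    by (simp add: binomial sum_distrib_left)
  finally show ?thesis .
qed

text \<open>
  The generalized Cayley formula: \<open>s \<cdot> n ^ (n - s - 1)\<close> forests on \<open>n\<close> vertices with \<open>s\<close> given roots,
  multiplied by \<open>n\<close> so that it holds over the naturals without a case for \<open>s = n\<close>. The induction
  hypothesis turns the sum over the first layer into the weighted binomial sum above.
\<close>

lemma card_forest_maps:
  assumes "finite M" "finite S" "M \<inter> S = {}"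
  shows "card (forest_maps M S) * (card M + card S) = card S * (card M + card S) ^ card M"
  using assms
proof (induction "card M" arbitrary: M S rule: less_induct)
  case less
  show ?case
  proof (cases "M = {}")
    case True
    then show ?thesis by (simp add: forest_maps_no_nonroots)
  next
    case False
    define m where "m = card M - 1"
    have m: "card M = Suc m" using False less.prems(1) by (simp add: m_def card_gt_0_iff)
    have layer: "card (forest_maps (M - B) B) * card M = card B * card M ^ (card M - card B)"
      if "B \<in> Pow M" for B
    proof (cases "B = {}")
      case True
      then show ?thesis using False by (simp add: forest_maps_no_roots)
    next
      case B: False
      have fB: "finite B" using that less.prems finite_subset by auto
      have c: "card (M - B) = card M - card B" "card B \<le> card M"
        using that fB less.prems by (auto simp: card_Diff_subset card_mono)
      have "card B > 0" using B fB by (simp add: card_gt_0_iff)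
      then have "card (M - B) < card M" using c by simp
      from less.hyps[OF this, of B] show ?thesis using c fB less.prems by (simp add: Diff_disjoint Int_commute)
    qed
    have "card (forest_maps M S) * card M
            = (\<Sum>B\<in>Pow M. card S ^ card B * (card (forest_maps (M - B) B) * card M))"
      using less.prems by (simp add: card_forest_maps_layers sum_distrib_right mult.assoc)
    also have "\<dots> = (\<Sum>B\<in>Pow M. card S ^ card B * (card B * card M ^ (card M - card B)))"
      using layer by (intro sum.cong) auto
    also have "\<dots> = card M * card S * (card S + card M) ^ m"
      unfolding sum_Pow_card[OF less.prems(1), of "\<lambda>b. card S ^ b * (b * card M ^ (card M - b))"]
      by (simp only: m weighted_binomial)
    finally have "Suc m * card (forest_maps M S) = Suc m * (card S * (card S + card M) ^ m)"
      by (simp only: m ac_simps)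
    then have "card (forest_maps M S) = card S * (card S + card M) ^ m"
      by (simp only: Suc_mult_cancel1)
    then show ?thesis by (simp add: m ac_simps)
  qed
qed

section \<open>Trees as parent maps\<close>

definition parent_edges :: "'a set \<Rightarrow> ('a \<Rightarrow> 'a) \<Rightarrow> 'a set set" where
  "parent_edges M f = (\<lambda>v. {v, f v}) ` M"

lemma in_parent_edges_iff:
  "{u, w} \<in> parent_edges M f \<longleftrightarrow> (u \<in> M \<and> w = f u) \<or> (w \<in> M \<and> u = f w)"
  by (auto simp: parent_edges_def doubleton_eq_iff image_iff)

text \<open>
  Depth strictly decreases towards the root; this is the measure behind acyclicity, uniqueness of
  parents and simplicity of the paths to the root.
\<close>

definition depth :: "('a \<Rightarrow> 'a) \<Rightarrow> 'a set \<Rightarrow> 'a \<Rightarrow> nat" where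
  "depth f S v = (LEAST i. (f ^^ i) v \<in> S)"

lemma depth_parent_less:
  assumes "leads_to f S v" "v \<notin> S"
  shows "depth f S (f v) < depth f S v"
proof -
  have "\<exists>i. (f ^^ i) v \<in> S"
    using assms(1)
  proof induction
    case (root v)
    then show ?case by (intro exI[of _ 0]) simp
  next
    case (step v)
    then obtain i where "(f ^^ i) (f v) \<in> S" by blast
    then show ?case by (intro exI[of _ "Suc i"]) (simp only: funpow_Suc_right o_apply)
  qed
  then obtain i where "(f ^^ i) v \<in> S" by blast
  then have "(LEAST i. (f ^^ i) v \<in> S) = Suc (LEAST i. (f ^^ Suc i) v \<in> S)"
    using assms(2) by (intro Least_Suc) auto
  then show ?thesis by (simp only: depth_def funpow_Suc_right o_apply)
qed

lemma sym_adjacency: "sym (adjacency E)"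
  by (auto simp: sym_def adjacency_def insert_commute)

lemma adjacency_rtrancl_sym: "(u, v) \<in> (adjacency E)\<^sup>* \<Longrightarrow> (v, u) \<in> (adjacency E)\<^sup>*"
  using sym_rtrancl[OF sym_adjacency] by (rule symD)

lemma parent_map_depth:
  assumes "f \<in> forest_maps (V - {r}) {r}" "v \<in> V" "v \<noteq> r"
  shows "f v \<in> V \<or> f v = r" "depth f {r} (f v) < depth f {r} v"
  using assms by (auto simp: forest_maps_def intro!: depth_parent_less)

text \<open>
  On a cycle, consider a vertex of maximal depth. Neither of its two neighbours can be a child of it,
  so both are its parent, hence they coincide; but a cycle of length at least three has distinct
  neighbours.
\<close>

lemma parent_edges_tree:
  assumes "finite V" "r \<in> V" and f: "f \<in> forest_maps (V - {r}) {r}"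
  shows "tree_graph V (parent_edges (V - {r}) f)"
proof -
  let ?E = "parent_edges (V - {r}) f" and ?d = "depth f {r}"
  note pd = parent_map_depth[OF f]
  have simple: "simple_graph V ?E"
  proof -
    have "f v \<noteq> v" if "v \<in> V" "v \<noteq> r" for v using pd(2)[OF that] by auto
    then have "card {v, f v} = 2" if "v \<in> V" "v \<noteq> r" for v
      using that by (metis card_2_iff)
    then show ?thesis using assms pd(1) by (auto simp: simple_graph_def parent_edges_def)
  qed
  have to_root: "(v, r) \<in> (adjacency ?E)\<^sup>*" if "v \<in> V" for v
  proof -
    have "leads_to f {r} v" using f that by (cases "v = r") (auto simp: forest_maps_def intro: leads_to.root)
    then show ?thesis using that
    proof induction
      case (step v)
      show ?case
      proof (cases "v = r")
        case False
        have "(v, f v) \<in> adjacency ?E"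
          using step.prems False by (auto simp: adjacency_def in_parent_edges_iff)
        moreover have "(f v, r) \<in> (adjacency ?E)\<^sup>*" using step pd(1)[of v] False assms(2) by auto
        ultimately show ?thesis by (rule converse_rtrancl_into_rtrancl)
      qed simp
    qed simp
  qed
  have "connected_graph V ?E"
    using to_root assms(2) unfolding connected_graph_def
    by (metis adjacency_rtrancl_sym empty_iff rtrancl_trans)
  moreover have "\<not> graph_cycle ?E p" for p
  proof
    assume c: "graph_cycle ?E p"
    define l where "l = length p"
    have l: "l \<ge> 3" "distinct p" and e: "\<And>i. i < l \<Longrightarrow> {p ! i, p ! (Suc i mod l)} \<in> ?E"
      using c by (auto simp: graph_cycle_def l_def)
    obtain i where i: "i < l" and max: "\<And>j. j < l \<Longrightarrow> ?d (p ! j) \<le> ?d (p ! i)"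
    proof -
      let ?D = "(\<lambda>i. ?d (p ! i)) ` {..<l}"
      have "Max ?D \<in> ?D" using l by (intro Max_in) (auto simp: lessThan_empty_iff)
      then obtain i where "i < l" "?d (p ! i) = Max ?D" by auto
      then show thesis using that[of i] by simp
    qed
    have up: "w = f (p ! i)" if "{p ! i, w} \<in> ?E" "?d w \<le> ?d (p ! i)" for w
      using that pd(2)[of w] by (auto simp: in_parent_edges_iff)
    \<comment> \<open>The index of the cyclic predecessor.\<close>
    define j where "j = (if i = 0 then l - 1 else i - 1)"
    have j: "j < l" "Suc j mod l = i" using i l by (auto simp: j_def)
    have "p ! (Suc i mod l) = f (p ! i)" using e[OF i] max l by (intro up) auto
    moreover have "p ! j = f (p ! i)" using e[OF j(1)] j max by (intro up) (auto simp: insert_commute)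
    moreover have "Suc i mod l < l" using l by simp
    ultimately have "Suc i mod l = j" using j l(2) by (metis l_def nth_eq_iff_index_eq)
    moreover have "Suc i mod l = (if Suc i = l then 0 else Suc i)" using i by auto
    ultimately show False using i l by (auto simp: j_def split: if_splits)
  qed
  ultimately show ?thesis using simple by (auto simp: tree_graph_def)
qed

text \<open>
  By induction on the depth in \<open>f\<close>: if an edge between \<open>v\<close> and \<open>f v\<close> were directed the other way by
  \<open>g\<close>, then \<open>g (f v) = v\<close>, and the induction hypothesis at the shallower vertex \<open>f v\<close> would give
  \<open>f (f v) = v\<close>.
\<close>

lemma parent_edges_inj:
  "inj_on (parent_edges (V - {r})) (forest_maps (V - {r}) {r})"
proof (rule inj_onI)
  fix f g assume f: "f \<in> forest_maps (V - {r}) {r}" and g: "g \<in> forest_maps (V - {r}) {r}"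
    and eq: "parent_edges (V - {r}) f = parent_edges (V - {r}) g"
  have "f v = g v" if "v \<in> V - {r}" for v
    using that
  proof (induction "depth f {r} v" arbitrary: v rule: less_induct)
    case less
    have "{v, f v} \<in> parent_edges (V - {r}) g"
      using less.prems eq[symmetric] by (auto simp: in_parent_edges_iff)
    then consider "f v = g v" | "f v \<in> V - {r}" "v = g (f v)"
      by (auto simp: in_parent_edges_iff)
    then show ?case
    proof cases
      case 2
      have d: "depth f {r} (f v) < depth f {r} v" using parent_map_depth[OF f] less.prems by auto
      then have "f (f v) = v" using less.hyps 2 by metis
      then show ?thesis using d parent_map_depth(2)[OF f, of "f v"] 2 by auto
    qed
  qed
  then show "f = g" using f g by (auto simp: forest_maps_def intro: PiE_ext)
qed

lemma rtrancl_simple_path: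
  assumes "(u, v) \<in> R\<^sup>*"
  shows "\<exists>p. p \<noteq> [] \<and> hd p = u \<and> last p = v \<and> distinct p \<and> successively (\<lambda>x y. (x, y) \<in> R) p"
  using assms
proof (induction rule: converse_rtrancl_induct)
  case base
  show ?case by (intro exI[of _ "[v]"]) simp
next
  case (step u w)
  then obtain p where p: "p \<noteq> []" "hd p = w" "last p = v" "distinct p"
    "successively (\<lambda>x y. (x, y) \<in> R) p" by blast
  show ?case
  proof (cases "u \<in> set p")
    case True
    then obtain xs ys where "p = xs @ u # ys" by (auto simp: in_set_conv_decomp)
    then show ?thesis using p by (intro exI[of _ "u # ys"]) (auto simp: successively_append_iff)
  next
    case False
    then show ?thesis using p step by (intro exI[of _ "u # p"]) (auto simp: successively_Cons)
  qed
qed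

text \<open>
  Take as parent of \<open>v\<close> a neighbour closer to the root. The parent edges form a spanning tree
  contained in \<open>E\<close>; a further edge of \<open>E\<close> would close a cycle with the simple path that joins its
  endpoints inside that spanning tree.
\<close>

lemma tree_from_parent_edges:
  assumes tree: "tree_graph V E" and r: "r \<in> V"
  shows "E \<in> parent_edges (V - {r}) ` forest_maps (V - {r}) {r}"
proof -
  let ?R = "adjacency E"
  have fin: "finite V" and edges: "\<And>e. e \<in> E \<Longrightarrow> e \<subseteq> V \<and> card e = 2"
    and conn: "\<And>v. v \<in> V \<Longrightarrow> (v, r) \<in> ?R\<^sup>*" and acyc: "\<And>p. \<not> graph_cycle E p"
    using tree r by (auto simp: tree_graph_def simple_graph_def connected_graph_def)
  define dist where "dist v = (LEAST i. (v, r) \<in> ?R ^^ i)" for v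
  have "\<exists>u. (v, u) \<in> ?R \<and> dist u < dist v" if "v \<in> V" "v \<noteq> r" for v
  proof -
    have "\<exists>i. (v, r) \<in> ?R ^^ i" using conn[OF that(1)] by (simp add: rtrancl_power)
    then have "(v, r) \<in> ?R ^^ dist v" unfolding dist_def by (rule LeastI_ex)
    moreover obtain m where m: "dist v = Suc m"
      using calculation \<open>v \<noteq> r\<close> by (cases "dist v") auto
    ultimately obtain u where u: "(v, u) \<in> ?R" "(u, r) \<in> ?R ^^ m"
      by (metis relpow_Suc_E2)
    have "dist u \<le> m" unfolding dist_def using u(2) by (rule Least_le)
    then show ?thesis using u m by auto
  qed
  then obtain g where g: "\<And>v. v \<in> V \<Longrightarrow> v \<noteq> r \<Longrightarrow> (v, g v) \<in> ?R \<and> dist (g v) < dist v" by metis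
  define f where "f = restrict g (V - {r})"
  have f: "(v, f v) \<in> ?R" "dist (f v) < dist v" "f v \<in> V" if "v \<in> V" "v \<noteq> r" for v
    using g[OF that] that edges[of "{v, f v}"] by (auto simp: f_def adjacency_def)
  have "leads_to f {r} v" if "v \<in> V" for v
    using that
  proof (induction "dist v" arbitrary: v rule: less_induct)
    case less
    then show ?case using f[of v] by (cases "v = r") (auto intro: leads_to.root leads_to.step)
  qed
  then have fm: "f \<in> forest_maps (V - {r}) {r}"
    using f r by (auto simp: forest_maps_def f_def)
  let ?F = "parent_edges (V - {r}) f"
  have sub: "?F \<subseteq> E" using f(1) by (auto simp: parent_edges_def adjacency_def)
  have "E \<subseteq> ?F"
  proof (rule ccontr)
    assume "\<not> E \<subseteq> ?F"
    then obtain e where e: "e \<in> E" "e \<notin> ?F" by blast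
    then obtain u v where uv: "e = {u, v}" "u \<noteq> v" using edges[OF e(1)] by (auto simp: card_2_iff)
    then have "u \<in> V" "v \<in> V" using edges[OF e(1)] by auto
    then have "(u, v) \<in> (adjacency ?F)\<^sup>*"
      using parent_edges_tree[OF fin r fm] by (auto simp: tree_graph_def connected_graph_def)
    then obtain p where p: "p \<noteq> []" "hd p = u" "last p = v" "distinct p"
      "successively (\<lambda>x y. (x, y) \<in> adjacency ?F) p"
      using rtrancl_simple_path by metis
    have step: "{p ! i, p ! Suc i} \<in> ?F" if "Suc i < length p" for i
      using p(5) that by (auto simp: successively_conv_nth adjacency_def)
    have len: "length p \<ge> 3"
    proof (rule ccontr)
      assume "\<not> 3 \<le> length p"
      moreover have "length p > 0" using p(1) by simp
      ultimately have "length p = 1 \<or> length p = 2" by linarith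
      then show False
        using p(1-3) uv e(2) step[of 0] by (auto simp: length_Suc_conv numeral_2_eq_2)
    qed
    have "{p ! i, p ! (Suc i mod length p)} \<in> E" if "i < length p" for i
    proof (cases "Suc i = length p")
      case True
      then have "p ! i = v" "p ! (Suc i mod length p) = u"
        using p(1-3) by (auto simp: last_conv_nth hd_conv_nth simp flip: True)
      then show ?thesis using uv e by (simp add: insert_commute)
    next
      case False
      then show ?thesis using step[of i] that sub by auto
    qed
    then have "graph_cycle E p" using len p(4) by (simp add: graph_cycle_def)
    then show False using acyc by blast
  qed
  then show ?thesis using sub fm by blast
qed

lemma parent_edges_bij:
  assumes "finite V" "r \<in> V"
  shows "bij_betw (parent_edges (V - {r})) (forest_maps (V - {r}) {r}) {E. tree_graph V E}"
proof (rule bij_betw_imageI)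
  show "parent_edges (V - {r}) ` forest_maps (V - {r}) {r} = {E. tree_graph V E}"
    using parent_edges_tree[OF assms] tree_from_parent_edges[OF _ assms(2)] by auto
qed (rule parent_edges_inj)

section \<open>Paths to the root\<close>

definition follows :: "('a \<Rightarrow> 'a) \<Rightarrow> 'a list \<Rightarrow> bool" where
  "follows f p \<longleftrightarrow> successively (\<lambda>u v. f u = v) p"

lemma follows_Cons: "follows f (v # p) \<longleftrightarrow> p = [] \<or> f v = hd p \<and> follows f p"
  by (auto simp: follows_def successively_Cons)

lemma follows_singleton [simp]: "follows f [v]"
  by (simp add: follows_Cons)

text \<open>
  The paths of the rooted tree \<open>f\<close> that climb to the root \<open>r\<close> within \<open>K\<close>, listed from the lower end.
\<close>

definition parent_paths :: "'a set \<Rightarrow> 'a \<Rightarrow> ('a \<Rightarrow> 'a) \<Rightarrow> 'a list set" where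
  "parent_paths K r f = {p. p \<noteq> [] \<and> distinct p \<and> set p \<subseteq> K \<and> last p = r
     \<and> follows f p}"

lemma parent_path_depth:
  assumes f: "f \<in> forest_maps (V - {r}) {r}" and "K \<subseteq> V" "p \<in> parent_paths K r f" "x \<in> set p"
  shows "depth f {r} x \<le> depth f {r} (hd p)"
  using assms(3,4)
proof (induction p)
  case (Cons v q)
  show ?case
  proof (cases "q = []")
    case False
    then have q: "q \<in> parent_paths K r f" "f v = hd q"
      using Cons.prems by (auto simp: parent_paths_def follows_Cons)
    have "r \<in> set q" using q(1) by (auto simp: parent_paths_def)
    then have "v \<noteq> r" "v \<in> V" using Cons.prems assms(2) by (auto simp: parent_paths_def)
    then have "depth f {r} (hd q) < depth f {r} v" using parent_map_depth(2)[OF f] q(2) by metis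
    then show ?thesis using Cons.IH[OF q(1)] Cons.prems(2) by auto
  qed (use Cons.prems in auto)
qed simp

lemma inj_on_hd_parent_paths: "inj_on hd (parent_paths K r f)"
proof (rule inj_onI)
  fix p q assume "p \<in> parent_paths K r f" "q \<in> parent_paths K r f" "hd p = hd q"
  then show "p = q"
  proof (induction p arbitrary: q)
    case (Cons v p)
    then obtain q' where q: "q = v # q'" by (cases q) (auto simp: parent_paths_def)
    have stop: "xs = []" if "v # xs \<in> parent_paths K r f" "v = r" for xs
      using that last_in_set[of xs] by (auto simp: parent_paths_def split: if_splits)
    show ?case
    proof (cases "v = r")
      case True
      then show ?thesis using stop Cons.prems q by blast
    next
      case False
      then have "p \<noteq> []" "q' \<noteq> []" using Cons.prems q by (auto simp: parent_paths_def)
      then show ?thesis using Cons.IH[of q'] Cons.prems q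
        by (auto simp: parent_paths_def follows_Cons)
    qed
  qed (simp add: parent_paths_def)
qed

text \<open>
  A vertex lies in the cluster of the root iff its whole ancestral line lies in \<open>K\<close>: crossing an edge
  inside \<open>K\<close> either drops the first vertex of such a line or puts a child in front of it. Together
  with \<open>inj_on_hd_parent_paths\<close> this lets one count paths instead of cluster vertices.
\<close>

lemma component_parent_paths:
  assumes f: "f \<in> forest_maps (V - {r}) {r}" and K: "K \<subseteq> V" "r \<in> K"
  shows "component_of_vertex K (induced_edges (parent_edges (V - {r}) f) K) r
           = hd ` parent_paths K r f"
proof -
  let ?R = "adjacency (induced_edges (parent_edges (V - {r}) f) K)"
  have R: "(u, w) \<in> ?R \<longleftrightarrow> u \<in> K \<and> w \<in> K \<and> ((u \<noteq> r \<and> w = f u) \<or> (w \<noteq> r \<and> u = f w))" for u w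
    using K by (auto simp: adjacency_def induced_edges_def in_parent_edges_iff)
  have "u \<in> hd ` parent_paths K r f" if "(r, u) \<in> ?R\<^sup>*" for u
    using that
  proof induction
    case base
    have "[r] \<in> parent_paths K r f" using K by (simp add: parent_paths_def)
    then show ?case by force
  next
    case (step u w)
    from step.IH obtain p where p: "p \<in> parent_paths K r f" "hd p = u" by blast
    from step.hyps(2) have w: "w \<in> K" and "(u \<noteq> r \<and> w = f u) \<or> (w \<noteq> r \<and> u = f w)"
      using R by auto
    then consider "u \<noteq> r" "w = f u" | "w \<noteq> r" "u = f w" by blast
    then show ?case
    proof cases
      case 1
      obtain q where q: "p = u # q" using p by (cases p) (auto simp: parent_paths_def)
      then have "q \<in> parent_paths K r f" "hd q = w"
        using p 1 by (auto simp: parent_paths_def follows_Cons)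
      then show ?thesis by blast
    next
      case 2
      have "depth f {r} u < depth f {r} w" using parent_map_depth(2)[OF f] w K 2 by blast
      then have "w \<notin> set p" using parent_path_depth[OF f K(1) p(1)] p(2) by fastforce
      then have "w # p \<in> parent_paths K r f"
        using p w 2 by (auto simp: parent_paths_def follows_Cons)
      then show ?thesis by force
    qed
  qed
  moreover have "(hd p, r) \<in> ?R\<^sup>*" if "p \<in> parent_paths K r f" for p
    using that
  proof (induction p)
    case (Cons v q)
    show ?case
    proof (cases "q = []")
      case False
      then have q: "q \<in> parent_paths K r f" "f v = hd q"
        using Cons.prems by (auto simp: parent_paths_def follows_Cons)
      have "r \<in> set q" using q(1) by (auto simp: parent_paths_def)
      then have "v \<noteq> r" using Cons.prems by (auto simp: parent_paths_def)
      then have "(v, hd q) \<in> ?R" 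
        unfolding R using Cons.prems q False by (auto simp: parent_paths_def)
      then show ?thesis using Cons.IH[OF q(1)] by (auto intro: converse_rtrancl_into_rtrancl)
    qed (use Cons.prems in \<open>auto simp: parent_paths_def\<close>)
  qed (simp add: parent_paths_def)
  moreover have "hd p \<in> K" if "p \<in> parent_paths K r f" for p
    using that by (auto simp: parent_paths_def)
  ultimately show ?thesis
    by (auto simp: component_of_vertex_def intro: adjacency_rtrancl_sym)
qed

text \<open>
  Prescribing a root \<open>w\<close> as the parent of \<open>v\<close> amounts to promoting \<open>v\<close> to a root.
\<close>

lemma forest_maps_attach:
  assumes "v \<in> M" "v \<notin> S" "w \<in> S" "M \<inter> S = {}"
  shows "bij_betw (\<lambda>f. restrict f (M - {v})) {f \<in> forest_maps M S. f v = w}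
           (forest_maps (M - {v}) (insert v S))"
proof (rule bij_betw_byWitness[where f' = "\<lambda>h. h(v := w)"], goal_cases)
  case 1
  show ?case using assms by (auto simp: forest_maps_def fun_eq_iff PiE_def extensional_def)
next
  case 2
  show ?case using assms by (auto simp: forest_maps_def fun_eq_iff PiE_def extensional_def restrict_def)
next
  case 3
  show ?case
  proof (rule image_subsetI)
    fix f assume "f \<in> {f \<in> forest_maps M S. f v = w}"
    then have f: "f \<in> forest_maps M S" "w = f v" by auto
    let ?h = "restrict f (M - {v})"
    have fM: "f u \<in> M \<union> S" if "u \<in> M" for u using f that by (auto simp: forest_maps_def)
    have "leads_to ?h (insert v S) u" if "u \<in> M" for u
    proof (rule leads_to_cong[where M = "M \<union> S"])
      show "leads_to f S u" using f that by (auto simp: forest_maps_def)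
    qed (use that fM in \<open>auto intro: leads_to.root\<close>)
    then show "?h \<in> forest_maps (M - {v}) (insert v S)"
      using fM by (auto simp: forest_maps_def)
  qed
next
  case 4
  show ?case
  proof (rule image_subsetI)
    fix h assume h: "h \<in> forest_maps (M - {v}) (insert v S)"
    let ?f = "h(v := w)"
    have hM: "h u \<in> M \<union> S" if "u \<in> M" "u \<noteq> v" for u using h that assms by (auto simp: forest_maps_def)
    have v: "leads_to ?f S v"
      by (rule leads_to.step, rule leads_to.root) (simp add: assms(3))
    have "leads_to ?f S u" if "u \<in> M" for u
    proof (cases "u = v")
      case False
      show ?thesis
      proof (rule leads_to_cong[where M = "M \<union> S"])
        show "leads_to h (insert v S) u" using h that False by (auto simp: forest_maps_def)
      qed (use that hM v in \<open>auto intro: leads_to.root\<close>)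
    qed (use v in simp)
    moreover have "?f \<in> M \<rightarrow>\<^sub>E M \<union> S"
      using h hM assms by (auto simp: forest_maps_def PiE_def extensional_def)
    ultimately show "?f \<in> {f \<in> forest_maps M S. f v = w}" by (auto simp: forest_maps_def)
  qed
qed

lemma bij_betw_Collect_cong:
  assumes "bij_betw F A B" "\<And>x. x \<in> A \<Longrightarrow> Q (F x) \<longleftrightarrow> P x"
  shows "bij_betw F {x \<in> A. P x} {y \<in> B. Q y}"
proof -
  have "inj_on F {x \<in> A. P x}"
    using assms(1) by (rule inj_on_subset[OF bij_betw_imp_inj_on]) blast
  moreover have "F ` {x \<in> A. P x} = {y \<in> B. Q y}"
    using assms(2) bij_betw_imp_surj_on[OF assms(1)] by blast
  ultimately show ?thesis by (rule bij_betw_imageI)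
qed

text \<open>
  Attaching the path vertex by vertex, starting from the root: erasing the edges of the path from a
  tree that contains it leaves a forest in which every vertex of the path is a root.
\<close>

lemma forest_maps_along_path:
  assumes "p \<noteq> []" "distinct p" "set p \<subseteq> V"
  shows "bij_betw (\<lambda>f. restrict f (V - set p))
     {f \<in> forest_maps (V - {last p}) {last p}. follows f p}
     (forest_maps (V - set p) (set p))"
  using assms
proof (induction p)
  case (Cons v p)
  show ?case
  proof (cases "p = []")
    case True
    have "restrict f (V - {v}) = id f" if "f \<in> forest_maps (V - {v}) {v}" for f
      using that by (auto simp: forest_maps_def intro: PiE_restrict)
    then have "bij_betw (\<lambda>f. restrict f (V - {v})) (forest_maps (V - {v}) {v}) (forest_maps (V - {v}) {v})"
      by (subst bij_betw_cong[where g = id]) auto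
    moreover have "{f \<in> forest_maps (V - {last (v # p)}) {last (v # p)}.
        follows f (v # p)} = forest_maps (V - {v}) {v}" "set (v # p) = {v}"
      using True by auto
    ultimately show ?thesis by (simp only:)
  next
    case False
    define w where "w = hd p"
    have w: "w \<in> set p" using False by (simp add: w_def)
    have v: "v \<in> V" "v \<notin> set p" using Cons.prems by auto
    let ?P = "{f \<in> forest_maps (V - {last p}) {last p}. follows f p}"
    have IH: "bij_betw (\<lambda>f. restrict f (V - set p)) ?P (forest_maps (V - set p) (set p))"
      by (rule Cons.IH) (use False Cons.prems in auto)
    have "bij_betw (\<lambda>f. restrict f (V - set p)) {f \<in> ?P. f v = w}
            {h \<in> forest_maps (V - set p) (set p). h v = w}"
      using IH v by (intro bij_betw_Collect_cong) auto
    moreover have "bij_betw (\<lambda>f. restrict f (V - set p - {v})) {h \<in> forest_maps (V - set p) (set p). h v = w}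
            (forest_maps (V - set p - {v}) (insert v (set p)))"
      using v w by (intro forest_maps_attach) auto
    ultimately have bij: "bij_betw ((\<lambda>f. restrict f (V - set p - {v})) \<circ> (\<lambda>f. restrict f (V - set p)))
       {f \<in> ?P. f v = w} (forest_maps (V - set p - {v}) (insert v (set p)))"
      by (rule bij_betw_trans)
    have dom: "{f \<in> ?P. f v = w} = {f \<in> forest_maps (V - {last (v # p)}) {last (v # p)}. follows f (v # p)}"
      using False by (auto simp: follows_Cons w_def)
    have res: "restrict (restrict f (V - set p)) (V - set (v # p)) = restrict f (V - set (v # p))" for f
      by (auto simp: fun_eq_iff restrict_def)
    have sets: "V - set p - {v} = V - set (v # p)" "insert v (set p) = set (v # p)" by auto
    show ?thesis using bij by (simp only: comp_def dom res sets)
  qed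
qed simp

lemma real_card_forest_maps:
  assumes "finite V" "S \<subseteq> V" "V \<noteq> {}"
  shows "real (card (forest_maps (V - S) S)) = real (card S) * real (card V) ^ (card V - card S) / real (card V)"
proof -
  have fS: "finite S" using assms finite_subset by auto
  have c: "card (V - S) = card V - card S" "card S \<le> card V"
    using assms fS by (auto simp: card_Diff_subset card_mono)
  have "card (forest_maps (V - S) S) * card V = card S * card V ^ (card V - card S)"
    using card_forest_maps[of "V - S" S] assms fS c by auto
  then have "real (card (forest_maps (V - S) S)) * real (card V) = real (card S) * real (card V) ^ (card V - card S)"
    by (metis of_nat_mult of_nat_power)
  then show ?thesis using assms by (simp add: field_simps)
qed

lemma card_trees:
  assumes "finite V" "V \<noteq> {}"
  shows "real (card {E. tree_graph V E}) = real (card V) ^ (card V - 1) / real (card V)"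
proof -
  obtain r where r: "r \<in> V" using assms by blast
  show ?thesis
    using bij_betw_same_card[OF parent_edges_bij[OF assms(1) r]] real_card_forest_maps[of V "{r}"] assms r
    by simp
qed

section \<open>The exact expectation\<close>

lemma rooted_labeled_trees_Sigma:
  "rooted_labeled_trees n = {E. tree_graph {1..n} E} \<times> {1..n}"
  unfolding rooted_labeled_trees_def by blast

lemma finite_trees:
  assumes "finite V"
  shows "finite {E. tree_graph V E}"
proof (rule finite_subset)
  show "{E. tree_graph V E} \<subseteq> Pow (Pow V)" unfolding tree_graph_def simple_graph_def by blast
  show "finite (Pow (Pow V))" using assms by simp
qed

lemma card_rooted_labeled_trees:
  assumes "n \<ge> 1"
  shows "real (card (rooted_labeled_trees n)) = real n ^ (n - 1)"
proof -
  have "real (card {E. tree_graph {1..n} E}) = real n ^ (n - 1) / real n"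
    using card_trees[of "{1..n}"] assms by simp
  then show ?thesis using assms
    by (simp only: rooted_labeled_trees_Sigma card_cartesian_product of_nat_mult card_atLeastAtMost) simp
qed

lemma root_cluster_size_parent_paths:
  assumes f: "f \<in> forest_maps ({1..n} - {r}) {r}" and "k \<le> n"
  shows "root_cluster_size k (parent_edges ({1..n} - {r}) f, r) = card (parent_paths {1..k} r f)"
proof (cases "r \<in> {1..k}")
  case True
  have "{1..k} \<subseteq> {1..n}" using assms by auto
  from component_parent_paths[OF f this True] show ?thesis
    by (simp only: root_cluster_size_def split if_P[OF True] card_image[OF inj_on_hd_parent_paths])
next
  case False
  moreover have "r \<in> {1..k}" if "p \<in> parent_paths {1..k} r f" for p
    using that last_in_set[of p] by (auto simp: parent_paths_def)
  ultimately have "parent_paths {1..k} r f = {}" by blast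
  then show ?thesis using False by (simp only: root_cluster_size_def split if_False card.empty)
qed

definition simple_lists :: "'a set \<Rightarrow> 'a list set" where
  "simple_lists K = {p. p \<noteq> [] \<and> distinct p \<and> set p \<subseteq> K}"

lemma simple_lists_sum:
  fixes g :: "nat \<Rightarrow> real"
  assumes "finite K"
  shows "finite (simple_lists K)"
    "(\<Sum>p\<in>simple_lists K. g (length p))
       = (\<Sum>j=1..card K. falling_factorial (real (card K)) j * g j)"
proof -
  have len: "length p \<in> {1..card K}" if "p \<in> simple_lists K" for p
  proof -
    have "card (set p) \<le> card K" using that assms by (intro card_mono) (auto simp: simple_lists_def)
    then show ?thesis using that
      by (cases p) (auto simp: simple_lists_def distinct_card)
  qed
  have "simple_lists K \<subseteq> {p. set p \<subseteq> K \<and> length p \<le> card K}"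
    using len by (auto simp: simple_lists_def)
  then show fin: "finite (simple_lists K)"
    using finite_lists_length_le[OF assms] finite_subset by blast
  have ff: "real (card {p \<in> simple_lists K. length p = j}) = falling_factorial (real (card K)) j"
    if j: "j \<in> {1..card K}" for j
  proof -
    have "{p \<in> simple_lists K. length p = j} = {p. length p = j \<and> distinct p \<and> set p \<subseteq> K}"
      using j by (auto simp: simple_lists_def)
    then have "card {p \<in> simple_lists K. length p = j} = \<Prod>{card K - j + 1..card K}"
      using card_lists_distinct_length_eq[OF assms, of j] j by auto
    \<comment> \<open>The substitution \<open>i \<mapsto> card K - i\<close> reverses the order of the factors.\<close>
    also have "\<dots> = (\<Prod>i<j. card K - i)"
      using j by (intro prod.reindex_bij_witness[where i = "\<lambda>i. card K - i" and j = "\<lambda>i. card K - i"]) auto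
    finally show ?thesis using j
      by (simp add: falling_factorial_def of_nat_prod of_nat_diff)
  qed
  have "(\<Sum>p\<in>simple_lists K. g (length p))
      = (\<Sum>j=1..card K. \<Sum>p\<in>{p \<in> simple_lists K. length p = j}. g (length p))"
    using len fin by (intro sum.group[symmetric]) auto
  also have "\<dots> = (\<Sum>j=1..card K. falling_factorial (real (card K)) j * g j)"
    using ff by (intro sum.cong) auto
  finally show "(\<Sum>p\<in>simple_lists K. g (length p))
       = (\<Sum>j=1..card K. falling_factorial (real (card K)) j * g j)" .
qed

text \<open>
  Double counting: sum over the potential paths first. By \<open>forest_maps_along_path\<close>, the number of
  rooted trees containing a path depends only on its number of vertices \<open>j\<close>, and is given by the
  forest count.
\<close>

lemma sum_root_cluster_size:
  assumes "1 \<le> n" "k \<le> n"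
  shows "(\<Sum>x\<in>rooted_labeled_trees n. real (root_cluster_size k x))
     = (\<Sum>j=1..k. falling_factorial (real k) j * (real j * real n ^ (n - j) / real n))"
proof -
  let ?V = "{1..n}" and ?K = "{1..k}" and ?L = "simple_lists {1..k}"
  let ?F = "\<lambda>r. forest_maps (?V - {r}) {r}"
  let ?S = "\<lambda>f p. follows f p"
  have finL: "finite ?L" by (rule simple_lists_sum) simp
  have finF: "finite (?F r)" for r by (intro finite_forest_maps) auto
  have last: "last p \<in> ?V" if "p \<in> ?L" for p
  proof -
    have "last p \<in> ?K" using that last_in_set[of p] unfolding simple_lists_def by blast
    then show ?thesis using assms by auto
  qed
  have paths: "parent_paths ?K r f = {p \<in> ?L. last p = r \<and> ?S f p}" for r f
    by (auto simp: parent_paths_def simple_lists_def)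
  have "(\<Sum>x\<in>rooted_labeled_trees n. real (root_cluster_size k x))
     = (\<Sum>r\<in>?V. \<Sum>E\<in>{E. tree_graph ?V E}. real (root_cluster_size k (E, r)))"
    unfolding rooted_labeled_trees_Sigma
    by (subst sum.swap) (simp add: sum.cartesian_product)
  also have "\<dots> = (\<Sum>r\<in>?V. \<Sum>f\<in>?F r. real (card (parent_paths ?K r f)))"
  proof (rule sum.cong)
    fix r assume r: "r \<in> ?V"
    show "(\<Sum>E\<in>{E. tree_graph ?V E}. real (root_cluster_size k (E, r)))
        = (\<Sum>f\<in>?F r. real (card (parent_paths ?K r f)))"
      using sum.reindex_bij_betw[OF parent_edges_bij[OF _ r], of "\<lambda>E. real (root_cluster_size k (E, r))"]
        root_cluster_size_parent_paths[OF _ assms(2)] by simp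
  qed simp
  also have "\<dots> = (\<Sum>r\<in>?V. \<Sum>f\<in>?F r. \<Sum>p\<in>?L. if last p = r \<and> ?S f p then 1 else 0)"
    unfolding paths using finL by (simp add: sum.If_cases Int_def)
  also have "\<dots> = (\<Sum>r\<in>?V. \<Sum>p\<in>?L. \<Sum>f\<in>?F r. if last p = r \<and> ?S f p then 1 else 0)"
    by (intro sum.cong refl sum.swap)
  also have "\<dots> = (\<Sum>p\<in>?L. \<Sum>r\<in>?V. \<Sum>f\<in>?F r. if last p = r \<and> ?S f p then 1 else 0)"
    by (rule sum.swap)
  also have "\<dots> = (\<Sum>p\<in>?L. \<Sum>r\<in>?V. if last p = r then real (card {f \<in> ?F r. ?S f p}) else 0)"
    using finF by (intro sum.cong refl) (auto simp: sum.If_cases Int_def)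
  also have "\<dots> = (\<Sum>p\<in>?L. real (card {f \<in> ?F (last p). ?S f p}))"
    using last by (intro sum.cong refl) (simp only: sum.delta' finite_atLeastAtMost if_True)
  also have "\<dots> = (\<Sum>p\<in>?L. real (length p) * real n ^ (n - length p) / real n)"
  proof (rule sum.cong)
    fix p assume "p \<in> ?L"
    then have p: "p \<noteq> []" "distinct p" "set p \<subseteq> ?V" using assms by (auto simp: simple_lists_def)
    show "real (card {f \<in> ?F (last p). ?S f p}) = real (length p) * real n ^ (n - length p) / real n"
      using bij_betw_same_card[OF forest_maps_along_path[OF p]] real_card_forest_maps[of ?V "set p"] p assms
      by (simp add: distinct_card)
  qed simp
  also have "\<dots> = (\<Sum>j=1..k. falling_factorial (real k) j * (real j * real n ^ (n - j) / real n))"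
    using simple_lists_sum(2)[of ?K "\<lambda>j. real j * real n ^ (n - j) / real n"] by simp
  finally show ?thesis .
qed

lemma expected_root_cluster_eq:
  assumes "1 \<le> n" "k \<le> n"
  shows "expected_root_cluster n k = (\<Sum>j=1..k. real j * falling_factorial (real k) j / real n ^ j)"
proof -
  let ?T = "rooted_labeled_trees n"
  have card: "real (card ?T) = real n ^ (n - 1)" using card_rooted_labeled_trees assms by blast
  have fin: "finite ?T" by (simp add: rooted_labeled_trees_Sigma finite_trees)
  moreover have ne: "?T \<noteq> {}" using card assms by (cases "?T = {}") auto
  ultimately have "expected_root_cluster n k = (\<Sum>x\<in>?T. real (root_cluster_size k x)) / real n ^ (n - 1)"
    by (simp add: expected_root_cluster_def root_cluster_pmf_def integral_pmf_of_set card)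
  also have "\<dots> = (\<Sum>j=1..k. real j * falling_factorial (real k) j / real n ^ j)"
    unfolding sum_root_cluster_size[OF assms] sum_divide_distrib
  proof (rule sum.cong)
    fix j assume "j \<in> {1..k}"
    then have "real n ^ (n - 1) * real n = real n ^ (n - j) * real n ^ j"
      using assms by (simp flip: power_add power_Suc2)
    then show "falling_factorial (real k) j * (real j * real n ^ (n - j) / real n) / real n ^ (n - 1)
       = real j * falling_factorial (real k) j / real n ^ j"
      using assms by (simp add: field_simps)
  qed simp
  finally show ?thesis .
qed

section \<open>Moment identities\<close>

text \<open>
  The probability that \<open>j\<close> labels drawn uniformly from \<open>{1..n}\<close> with replacement are distinct and all
  at most \<open>k\<close>.
\<close>

definition draw_prob :: "nat \<Rightarrow> nat \<Rightarrow> nat \<Rightarrow> real" where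
  "draw_prob n k j = falling_factorial (real k) j / real n ^ j"

definition draw_moment :: "nat \<Rightarrow> nat \<Rightarrow> nat \<Rightarrow> real" where
  "draw_moment n k i = (\<Sum>j\<le>k. real j ^ i * draw_prob n k j)"

lemma draw_prob_0 [simp]: "draw_prob n k 0 = 1"
  by (simp add: draw_prob_def falling_factorial_def)

lemma draw_prob_Suc: "draw_prob n k (Suc j) = draw_prob n k j * ((real k - real j) / real n)"
  by (simp add: draw_prob_def falling_factorial_def)

lemma draw_prob_prod: "draw_prob n k j = (\<Prod>i<j. (real k - real i) / real n)"
  by (induction j) (simp_all add: draw_prob_Suc)

lemma draw_prob_eq_0: "k < j \<Longrightarrow> draw_prob n k j = 0"
  unfolding draw_prob_prod by auto

lemma draw_prob_nonneg: "j \<le> k \<Longrightarrow> draw_prob n k j \<ge> 0"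
  unfolding draw_prob_prod by (intro prod_nonneg) auto

lemma draw_moment_nonneg: "draw_moment n k i \<ge> 0"
  unfolding draw_moment_def by (intro sum_nonneg) (auto simp: draw_prob_nonneg)

text \<open>
  Summation by parts: \<open>draw_prob n k (j + 1)\<close> is \<open>draw_prob n k j\<close> times \<open>(k - j) / n\<close>, and the term at
  \<open>j = k + 1\<close> vanishes. Choosing powers of \<open>j\<close> for \<open>g\<close> gives linear relations between the moments.
\<close>

lemma draw_prob_shift:
  "(\<Sum>j\<le>k. g j * draw_prob n k j)
     = g 0 + (\<Sum>j\<le>k. g (Suc j) * ((real k - real j) / real n) * draw_prob n k j)"
proof -
  have "(\<Sum>j\<le>k. g j * draw_prob n k j) = (\<Sum>j\<le>Suc k. g j * draw_prob n k j)"
    by (simp add: draw_prob_Suc)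
  also have "\<dots> = g 0 + (\<Sum>j\<le>k. g (Suc j) * draw_prob n k (Suc j))"
    by (subst sum.atMost_Suc_shift) simp
  finally show ?thesis by (simp add: draw_prob_Suc ac_simps)
qed

lemma draw_moment_linear:
  "(\<Sum>j\<le>k. (a + b * real j + c * real j ^ 2) * draw_prob n k j)
     = a * draw_moment n k 0 + b * draw_moment n k 1 + c * draw_moment n k 2"
  by (simp add: draw_moment_def sum_distrib_left flip: sum.distrib) 
     (intro sum.cong; simp add: algebra_simps)

lemma draw_moment_1:
  assumes "1 \<le> n" "k \<le> n"
  shows "draw_moment n k 1 = real n - (real n - real k) * draw_moment n k 0"
proof -
  have "draw_moment n k 0 = 1 + (\<Sum>j\<le>k. (real k / n + (- 1 / n) * real j + 0 * real j ^ 2) * draw_prob n k j)"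
    using draw_prob_shift[of "\<lambda>_. 1" n k] 
    by (simp add: draw_moment_def diff_divide_distrib)
  then show ?thesis unfolding draw_moment_linear using assms by (simp add: field_simps)
qed

text \<open>
  The shift identity for \<open>g j = j\<close> relates the moments of order 0, 1 and 2; \<open>draw_moment_1\<close> then
  eliminates the moment of order 0. The leading part reads \<open>E \<cdot> d\<^sup>2 = k \<cdot> n\<close>, which is where the
  common asymptotics \<open>k n / d\<^sup>2\<close> of all regimes with a gap beyond \<open>sqrt n\<close> come from.
\<close>

lemma draw_moment_balance:
  assumes "1 \<le> n" "k \<le> n"
  defines "d \<equiv> real n - real k"
  shows "draw_moment n k 1 * (d\<^sup>2 + real n) = real k * real n - d * draw_moment n k 2"
proof -
  have "draw_moment n k 1 = (\<Sum>j\<le>k. (real k / n + ((real k - 1) / n) * real j + (-1 / n) * real j ^ 2) * draw_prob n k j)"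
    using draw_prob_shift[of "\<lambda>j. real j" n k] assms(1)
    by (simp add: draw_moment_def power2_eq_square)
      (intro sum.cong refl arg_cong2[where f = "(*)"]; simp add: field_simps)
  then have "draw_moment n k 1 = real k / n * draw_moment n k 0 + (real k - 1) / n * draw_moment n k 1 + (-1 / n) * draw_moment n k 2"
    unfolding draw_moment_linear .
  from arg_cong[OF this, of "\<lambda>x. real n * x"]
  have "real n * draw_moment n k 1 = real n * (real k / n * draw_moment n k 0 + (real k - 1) / n * draw_moment n k 1 + (-1 / n) * draw_moment n k 2)" .
  also have "\<dots> = real k * draw_moment n k 0 + (real k - 1) * draw_moment n k 1 - draw_moment n k 2"
    using assms(1) by (simp add: distrib_left right_diff_distrib)
  finally have "real n * draw_moment n k 1 = real k * draw_moment n k 0 + (real k - 1) * draw_moment n k 1 - draw_moment n k 2" .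
  moreover have "d * draw_moment n k 0 = real n - draw_moment n k 1"
    using draw_moment_1[OF assms(1,2)] by (simp add: d_def)
  ultimately show ?thesis unfolding d_def by algebra
qed

text \<open>
  The shift identity for \<open>g j = j\<^sup>2\<close>, with \<open>k - j\<close> estimated by \<open>k\<close>, bounds the second moment by the
  lower ones, using only that the summands are nonnegative.
\<close>

lemma draw_moment_2_le:
  assumes "1 \<le> n" "k < n"
  defines "d \<equiv> real n - real k"
  shows "draw_moment n k 2 \<le> 2 * real k * real n ^ 2 / d ^ 3"
proof -
  let ?E = "draw_moment n k 1" and ?Q = "draw_moment n k 0" and ?M = "draw_moment n k 2"
  have d: "d > 0" "d \<le> n" using assms by (auto simp: d_def)
  have "?M = (\<Sum>j\<le>k. real (Suc j) ^ 2 * ((real k - real j) / real n) * draw_prob n k j)"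
    using draw_prob_shift[of "\<lambda>j. real j ^ 2" n k] by (simp add: draw_moment_def)
  also have "\<dots> \<le> (\<Sum>j\<le>k. (real k / n + 2 * (real k / n) * real j + (real k / n) * real j ^ 2) * draw_prob n k j)"
  proof (intro sum_mono mult_right_mono)
    fix j assume "j \<in> {..k}"
    have "real (Suc j) ^ 2 * ((real k - real j) / real n) \<le> real (Suc j) ^ 2 * (real k / real n)"
      by (intro mult_left_mono divide_right_mono) auto
    also have "\<dots> = real k / n + 2 * (real k / n) * real j + (real k / n) * real j ^ 2"
      by (simp add: power2_eq_square algebra_simps add_divide_distrib)
    finally show "real (Suc j) ^ 2 * ((real k - real j) / real n)
       \<le> real k / n + 2 * (real k / n) * real j + (real k / n) * real j ^ 2" .
  qed (auto simp: draw_prob_nonneg)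
  also have "\<dots> = real k / n * (?Q + 2 * ?E + ?M)"
    unfolding draw_moment_linear by (simp add: algebra_simps)
  finally have "?M * n \<le> k * (?Q + 2 * ?E + ?M)" using assms by (simp add: field_simps)
  then have M: "d * ?M \<le> k * (?Q + 2 * ?E)" unfolding d_def by (simp add: algebra_simps)
  have E: "?E * d\<^sup>2 \<le> k * n"
  proof -
    have "?E * (d\<^sup>2 + real n) \<le> k * n"
      using draw_moment_balance[of n k] assms d draw_moment_nonneg[of n k 2] by (simp add: d_def)
    moreover have "?E * real n \<ge> 0" using draw_moment_nonneg by simp
    ultimately show ?thesis by (simp add: algebra_simps)
  qed
  have Q: "?Q * d \<le> n" using draw_moment_1[of n k] assms draw_moment_nonneg[of n k 1]
    by (simp add: d_def mult.commute)
  have "?M * d ^ 3 = (d * ?M) * d ^ 2" by (simp add: power2_eq_square power3_eq_cube)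
  also have "\<dots> \<le> (k * (?Q + 2 * ?E)) * d ^ 2" using M by (intro mult_right_mono) auto
  also have "\<dots> = k * ((?Q * d) * d + 2 * (?E * d\<^sup>2))" by (simp add: power2_eq_square algebra_simps)
  also have "\<dots> \<le> k * (n * d + 2 * (k * n))"
    using Q E d by (intro mult_left_mono add_mono mult_right_mono) auto
  also have "\<dots> \<le> k * (2 * real n ^ 2)"
    using assms by (intro mult_left_mono) (auto simp: d_def power2_eq_square algebra_simps mult_left_mono)
  finally show ?thesis using d by (simp add: field_simps)
qed

lemma draw_moment_1_ratio:
  assumes "1 \<le> n" "k < n"
  defines "d \<equiv> real n - real k"
  defines "\<epsilon> \<equiv> real n / d\<^sup>2"
  shows "draw_moment n k 1 \<le> real k * real n / d\<^sup>2"
    "draw_moment n k 1 \<ge> real k * real n / d\<^sup>2 * ((1 - 2 * \<epsilon>) / (1 + \<epsilon>))"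
proof -
  let ?E = "draw_moment n k 1" and ?M = "draw_moment n k 2"
  have d: "d > 0" "d \<le> n" using assms by (auto simp: d_def)
  have bal: "?E * (d\<^sup>2 + n) = real k * real n - d * ?M"
    using draw_moment_balance[of n k] assms by (simp add: d_def)
  have "?E * d\<^sup>2 \<le> ?E * (d\<^sup>2 + n)" using draw_moment_nonneg by (intro mult_left_mono) auto
  also have "\<dots> \<le> real k * real n" using bal d draw_moment_nonneg[of n k 2] by simp
  finally show "?E \<le> real k * real n / d\<^sup>2" using d by (simp add: field_simps)
  have "d * ?M \<le> d * (2 * real k * real n ^ 2 / d ^ 3)"
    using draw_moment_2_le[of n k] assms d by (intro mult_left_mono) (auto simp: d_def)
  also have "\<dots> = real k * real n * (2 * \<epsilon>)"
    using d by (simp add: \<epsilon>_def field_simps power2_eq_square power3_eq_cube)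
  finally have "?E * (d\<^sup>2 + n) \<ge> real k * real n * (1 - 2 * \<epsilon>)" using bal by (simp add: algebra_simps)
  moreover have "d\<^sup>2 + n = d\<^sup>2 * (1 + \<epsilon>)" using d by (simp add: \<epsilon>_def field_simps)
  moreover have "1 + \<epsilon> > 0" using d by (simp add: \<epsilon>_def add_pos_nonneg)
  ultimately have "real k * real n * (1 - 2 * \<epsilon>) / (d\<^sup>2 * (1 + \<epsilon>)) \<le> ?E"
    using d by (subst pos_divide_le_eq) auto
  then show "?E \<ge> real k * real n / d\<^sup>2 * ((1 - 2 * \<epsilon>) / (1 + \<epsilon>))" by simp
qed

text \<open>
  The bounds of \<open>draw_moment_1_ratio\<close> have a relative error of order \<open>n / (n - k)\<^sup>2\<close>. Their common
  factor \<open>k n / (n - k)\<^sup>2\<close> makes them exact where \<open>k\<close> vanishes, so that \<open>k\<close> may be zero infinitely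
  often.
\<close>

lemma draw_moment_1_asymp:
  fixes k :: "nat \<Rightarrow> nat"
  assumes k: "\<And>n. k n \<le> n"
    and lim: "(\<lambda>n. real n / (real n - real (k n))\<^sup>2) \<longlonglongrightarrow> 0"
    and lt: "eventually (\<lambda>n. k n < n) sequentially"
  shows "(\<lambda>n. draw_moment n (k n) 1) \<sim>[sequentially] (\<lambda>n. real (k n) * real n / (real n - real (k n))\<^sup>2)"
proof (rule asymp_equiv_sandwich_real)
  let ?\<epsilon> = "\<lambda>n. real n / (real n - real (k n))\<^sup>2"
  let ?g = "\<lambda>n. real (k n) * real n / (real n - real (k n))\<^sup>2"
  have "(\<lambda>n. (1 - 2 * ?\<epsilon> n) / (1 + ?\<epsilon> n)) \<longlonglongrightarrow> 1"
  proof -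
    have "(\<lambda>n. (1 - 2 * ?\<epsilon> n) / (1 + ?\<epsilon> n)) \<longlonglongrightarrow> (1 - 2 * 0) / (1 + 0)"
      by (intro tendsto_intros lim) simp
    then show ?thesis by simp
  qed
  then have "(\<lambda>n. ?g n * ((1 - 2 * ?\<epsilon> n) / (1 + ?\<epsilon> n))) \<sim>[sequentially] (\<lambda>n. ?g n * 1)"
    by (intro asymp_equiv_intros tendsto_imp_asymp_equiv_const) auto
  then show "(\<lambda>n. ?g n * ((1 - 2 * ?\<epsilon> n) / (1 + ?\<epsilon> n))) \<sim>[sequentially] ?g" by simp
  show "eventually (\<lambda>n. draw_moment n (k n) 1
      \<in> {?g n * ((1 - 2 * ?\<epsilon> n) / (1 + ?\<epsilon> n))..?g n}) sequentially"
    using lt by eventually_elim (use draw_moment_1_ratio in \<open>auto simp: Suc_le_eq\<close>)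
qed simp

section \<open>The critical window\<close>

lemma sum_real_lessThan: "(\<Sum>i<j. real i) = real j * (real j - 1) / 2"
  by (induction j) (auto simp: field_simps)

lemma draw_prob_le_exp:
  assumes "1 \<le> n" "k \<le> n"
  shows "draw_prob n k j \<le> exp (- (real j * (real j - 1) / (2 * real n)))"
proof (cases "j \<le> k")
  case True
  have "draw_prob n k j \<le> (\<Prod>i<j. exp (- (real i / n)))"
    unfolding draw_prob_prod
  proof (rule prod_mono)
    fix i assume "i \<in> {..<j}"
    moreover have "(real k - real i) / n \<le> 1 + (- (real i / n))"
      using assms by (simp add: field_simps)
    ultimately show "0 \<le> (real k - real i) / n \<and> (real k - real i) / n \<le> exp (- (real i / n))"
      using True exp_ge_add_one_self[of "- (real i / n)"] by auto
  qed
  also have "\<dots> = exp (- (real j * (real j - 1) / (2 * real n)))"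
    by (simp add: sum_real_lessThan flip: exp_sum sum_divide_distrib add: sum_negf)
  finally show ?thesis .
next
  case False
  then show ?thesis by (simp add: draw_prob_eq_0)
qed

lemma tendsto_floor_scaled:
  assumes "0 \<le> t"
  shows "(\<lambda>n. real (nat \<lfloor>t * sqrt (real n)\<rfloor>) / sqrt (real n)) \<longlonglongrightarrow> t"
proof (rule tendsto_sandwich)
  have pos: "eventually (\<lambda>n. n > 0) sequentially" by (rule eventually_gt_at_top)
  show "eventually (\<lambda>n. t - 1 / sqrt (real n) \<le> real (nat \<lfloor>t * sqrt (real n)\<rfloor>) / sqrt (real n)) sequentially"
    using pos
  proof eventually_elim
    case (elim n)
    have "t * sqrt n - 1 \<le> real (nat \<lfloor>t * sqrt n\<rfloor>)" by linarith
    then have "(t * sqrt n - 1) / sqrt n \<le> real (nat \<lfloor>t * sqrt n\<rfloor>) / sqrt n"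
      by (intro divide_right_mono) auto
    then show ?case using elim by (simp add: diff_divide_distrib)
  qed
  show "eventually (\<lambda>n. real (nat \<lfloor>t * sqrt (real n)\<rfloor>) / sqrt (real n) \<le> t) sequentially"
    using pos
  proof eventually_elim
    case (elim n)
    have "real (nat \<lfloor>t * sqrt n\<rfloor>) \<le> t * sqrt n" using assms by (simp add: of_nat_floor)
    then show ?case using elim by (simp add: field_simps)
  qed
  have "(\<lambda>n. t - 1 / sqrt (real n)) \<longlonglongrightarrow> t - 0"
    by (intro tendsto_intros real_tendsto_divide_at_top[OF tendsto_const]
          filterlim_compose[OF sqrt_at_top] filterlim_real_sequentially)
  then show "(\<lambda>n. t - 1 / sqrt (real n)) \<longlonglongrightarrow> t" by simp
qed simp

text \<open>
  The summand is the product of the factors \<open>1 - (d + i) / n\<close> over \<open>i < j\<close>, and \<open>1 - x\<close> lies between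
  \<open>exp (- x - 2 x\<^sup>2)\<close> and \<open>exp (- x)\<close> for \<open>0 \<le> x \<le> 1 / 2\<close>; the exponent \<open>S\<close> is the sum of the
  \<open>(d + i) / n\<close>.
\<close>

lemma draw_prob_bounds:
  fixes j :: nat
  assumes "1 \<le> n" "k \<le> n"
  defines "d \<equiv> real n - real k"
  defines "S \<equiv> real j * d / n + real j * (real j - 1) / (2 * real n)"
  assumes small: "(d + real j) / n \<le> 1 / 2"
  shows "draw_prob n k j \<le> exp (- S)"
    "exp (- S - 2 * (real j * ((d + real j) / n)\<^sup>2)) \<le> draw_prob n k j"
proof -
  define x where "x i = (d + real i) / n" for i
  have d: "d \<ge> 0" using assms by (simp add: d_def)
  have eq: "draw_prob n k j = (\<Prod>i<j. 1 - x i)"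
    unfolding draw_prob_prod x_def d_def using assms(1)
    by (intro prod.cong) (auto simp: field_simps)
  have x: "0 \<le> x i" "x i \<le> (d + real j) / n" if "i < j" for i
    using that d by (auto simp: x_def divide_right_mono)
  have S: "(\<Sum>i<j. x i) = S"
    by (simp add: x_def S_def sum.distrib sum_real_lessThan add_divide_distrib flip: sum_divide_distrib)
  have "draw_prob n k j \<le> (\<Prod>i<j. exp (- x i))"
    unfolding eq
  proof (intro prod_mono conjI)
    fix i assume "i \<in> {..<j}"
    then have "x i \<le> 1 / 2" using order_trans[OF x(2)[of i] small] by blast
    then show "0 \<le> 1 - x i" "1 - x i \<le> exp (- x i)"
      using exp_ge_add_one_self[of "- x i"] by auto
  qed
  then show "draw_prob n k j \<le> exp (- S)" by (simp add: S sum_negf flip: exp_sum)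
  have "- S - 2 * (real j * ((d + real j) / n)\<^sup>2) = (\<Sum>i<j. - x i - 2 * ((d + real j) / n)\<^sup>2)"
    by (simp add: sum_subtractf sum_negf S)
  also have "exp \<dots> = (\<Prod>i<j. exp (- x i - 2 * ((d + real j) / n)\<^sup>2))" by (simp add: exp_sum)
  also have "\<dots> \<le> draw_prob n k j"
    unfolding eq
  proof (intro prod_mono conjI)
    fix i assume "i \<in> {..<j}"
    then have xi: "0 \<le> x i" "x i \<le> (d + real j) / n" "x i \<le> 1 / 2"
      using x[of i] order_trans[OF x(2)[of i] small] by auto
    have "- x i - 2 * ((d + real j) / n)\<^sup>2 \<le> - x i - 2 * (x i)\<^sup>2"
      using xi power_mono[of "x i" _ 2] by simp
    also have "\<dots> \<le> ln (1 - x i)" using xi by (intro ln_one_minus_pos_lower_bound) auto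
    finally have "exp (- x i - 2 * ((d + real j) / n)\<^sup>2) \<le> exp (ln (1 - x i))" by simp
    then show "exp (- x i - 2 * ((d + real j) / n)\<^sup>2) \<le> 1 - x i" using xi by simp
  qed simp
  finally show "exp (- S - 2 * (real j * ((d + real j) / n)\<^sup>2)) \<le> draw_prob n k j" .
qed

text \<open>
  For \<open>j\<close> near \<open>t sqrt n\<close> and \<open>d\<close> near \<open>c sqrt n\<close>, the main exponent tends to \<open>c t + t\<^sup>2 / 2\<close>, while the
  quadratic correction is of order \<open>1 / sqrt n\<close>.
\<close>

lemma draw_prob_tendsto:
  fixes k :: "nat \<Rightarrow> nat"
  assumes k: "\<And>n. k n \<le> n" and c: "(\<lambda>n. (real n - real (k n)) / sqrt (real n)) \<longlonglongrightarrow> c"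
    and t: "0 \<le> t"
  shows "(\<lambda>n. draw_prob n (k n) (nat \<lfloor>t * sqrt (real n)\<rfloor>)) \<longlonglongrightarrow> exp (- (c * t + t\<^sup>2 / 2))"
proof (rule tendsto_sandwich)
  define j where "j n = nat \<lfloor>t * sqrt (real n)\<rfloor>" for n
  define d where "d n = real n - real (k n)" for n
  \<comment> \<open>Everything is a polynomial in three sequences with limits \<open>t\<close>, \<open>c\<close> and \<open>0\<close>.\<close>
  define u where "u n = real (j n) / sqrt (real n)" for n
  define v where "v n = d n / sqrt (real n)" for n
  define w where "w n = 1 / sqrt (real n)" for n
  have u: "u \<longlonglongrightarrow> t" unfolding u_def j_def by (rule tendsto_floor_scaled[OF t])
  have v: "v \<longlonglongrightarrow> c" using c unfolding v_def d_def .
  have w: "w \<longlonglongrightarrow> 0"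
    unfolding w_def by (intro real_tendsto_divide_at_top[OF tendsto_const] filterlim_compose[OF sqrt_at_top] filterlim_real_sequentially)
  let ?S = "\<lambda>n. real (j n) * d n / n + real (j n) * (real (j n) - 1) / (2 * real n)"
  let ?R = "\<lambda>n. 2 * (real (j n) * ((d n + real (j n)) / n)\<^sup>2)"
  have pos: "eventually (\<lambda>n::nat. n \<ge> 1) sequentially" by (rule eventually_ge_at_top)
  have S_eq: "?S n = u n * v n + u n * (u n - w n) / 2" if "n \<ge> 1" for n
  proof -
    define s where "s = sqrt (real n)"
    have "s \<noteq> 0" "real n = s * s" using that by (simp_all add: s_def)
    then show ?thesis unfolding u_def v_def w_def s_def[symmetric] by (simp add: field_simps)
  qed
  have x_eq: "(d n + real (j n)) / n = (u n + v n) * w n" if "n \<ge> 1" for n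
  proof -
    define s where "s = sqrt (real n)"
    have "s \<noteq> 0" "real n = s * s" using that by (simp_all add: s_def)
    then show ?thesis unfolding u_def v_def w_def s_def[symmetric] by (simp add: field_simps)
  qed
  have R_eq: "?R n = 2 * (u n * (u n + v n)\<^sup>2 * w n)" if "n \<ge> 1" for n
  proof -
    define s where "s = sqrt (real n)"
    have "s \<noteq> 0" "real n = s * s" using that by (simp_all add: s_def)
    then show ?thesis unfolding u_def v_def w_def s_def[symmetric] by (simp add: field_simps power2_eq_square)
  qed
  have "(\<lambda>n. u n * v n + u n * (u n - w n) / 2) \<longlonglongrightarrow> t * c + t * (t - 0) / 2"
    by (intro tendsto_intros u v w) simp
  then have S: "?S \<longlonglongrightarrow> c * t + t\<^sup>2 / 2"
    using tendsto_cong[OF eventually_mono[OF pos S_eq]] by (simp add: power2_eq_square mult.commute)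
  have "(\<lambda>n. 2 * (u n * (u n + v n)\<^sup>2 * w n)) \<longlonglongrightarrow> 2 * (t * (t + c)\<^sup>2 * 0)"
    by (intro tendsto_intros u v w)
  then have R: "?R \<longlonglongrightarrow> 0"
    using tendsto_cong[OF eventually_mono[OF pos R_eq]] by simp
  have "(\<lambda>n. (u n + v n) * w n) \<longlonglongrightarrow> (t + c) * 0" by (intro tendsto_intros u v w)
  then have "eventually (\<lambda>n. (u n + v n) * w n < 1 / 2) sequentially" by (rule order_tendstoD) simp
  with pos have ev: "eventually (\<lambda>n. n \<ge> 1 \<and> (d n + real (j n)) / n \<le> 1 / 2) sequentially"
    by eventually_elim (simp add: x_eq)
  show "eventually (\<lambda>n. exp (- ?S n - ?R n) \<le> draw_prob n (k n) (nat \<lfloor>t * sqrt (real n)\<rfloor>)) sequentially"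
    using ev by eventually_elim (use draw_prob_bounds(2)[OF _ k] in \<open>simp only: d_def j_def\<close>)
  show "eventually (\<lambda>n. draw_prob n (k n) (nat \<lfloor>t * sqrt (real n)\<rfloor>) \<le> exp (- ?S n)) sequentially"
    using ev by eventually_elim (use draw_prob_bounds(1)[OF _ k] in \<open>simp only: d_def j_def\<close>)
  show "(\<lambda>n. exp (- ?S n)) \<longlonglongrightarrow> exp (- (c * t + t\<^sup>2 / 2))" by (intro tendsto_intros S)
  have "(\<lambda>n. exp (- ?S n - ?R n)) \<longlonglongrightarrow> exp (- (c * t + t\<^sup>2 / 2) - 0)" by (intro tendsto_intros S R)
  then show "(\<lambda>n. exp (- ?S n - ?R n)) \<longlonglongrightarrow> exp (- (c * t + t\<^sup>2 / 2))" by simp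
qed

text \<open>
  An integrable bound independent of \<open>n\<close> and \<open>k\<close>. The Gaussian decay is weakened to an
  exponential one, whose integral is elementary.
\<close>

lemma draw_prob_scaled_dominated:
  assumes "1 \<le> n" "k \<le> n" "0 \<le> t"
  shows "draw_prob n k (nat \<lfloor>t * sqrt (real n)\<rfloor>) \<le> exp 4 * exp (- t)"
proof -
  define s where "s = sqrt (real n)"
  define x where "x = t * s"
  define j where "j = nat \<lfloor>x\<rfloor>"
  have s: "s \<ge> 1" "real n = s * s" using assms by (auto simp: s_def)
  have x: "x \<ge> 0" using assms s by (simp add: x_def)
  have j: "real j \<le> x" "x - 1 \<le> real j" using x unfolding j_def by linarith+
  \<comment> \<open>Replacing \<open>j\<close> by \<open>x - 1\<close> is legitimate only where both factors stay nonnegative.\<close>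
  have "x * (x - 3) \<le> real j * (real j - 1)"
  proof -
    consider "x \<le> 2" | "x \<ge> 2" by linarith
    then show ?thesis
    proof cases
      case 1
      then have "x * (x - 3) \<le> 0" using x by (simp add: mult_nonneg_nonpos)
      moreover have "0 \<le> real j * (real j - 1)" by (cases j) auto
      ultimately show ?thesis by linarith
    next
      case 2
      then have "(x - 1) * (x - 2) \<le> real j * (real j - 1)" using j by (intro mult_mono) auto
      then show ?thesis by (simp add: algebra_simps)
    qed
  qed
  then have "x * (x - 3) / (2 * real n) \<le> real j * (real j - 1) / (2 * real n)" by (intro divide_right_mono) auto
  moreover have "x * (x - 3) / (2 * real n) = t\<^sup>2 / 2 - (3 / 2) * (t / s)"
    using s by (simp add: x_def field_simps power2_eq_square)
  moreover have "t / s \<le> t / 1" using s(1) assms(3) by (intro divide_left_mono) auto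
  \<comment> \<open>Completing the square gives \<open>t - 25 / 8\<close>, which the constant 4 covers.\<close>
  moreover have "t - 4 \<le> t\<^sup>2 / 2 - (3 / 2) * t"
    using zero_le_power2[of "t - 5 / 2"] by (simp add: power2_eq_square algebra_simps)
  ultimately have "- (real j * (real j - 1) / (2 * real n)) \<le> 4 - t" by simp
  then have "exp (- (real j * (real j - 1) / (2 * real n))) \<le> exp (4 + - t)" by simp
  then show ?thesis using draw_prob_le_exp[OF assms(1,2), of j] unfolding exp_add j_def x_def s_def by linarith
qed

lemma integrable_exp_minus_Ici: "integrable lborel (\<lambda>t::real. exp (- t) * indicator {0..} t)"
  using has_bochner_integral_I0i_power_exp_m'[of 0] by (auto simp: has_bochner_integral_iff)

text \<open>
  The sum of the \<open>draw_prob n k j\<close> is the integral of a step function with steps of width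
  \<open>1 / sqrt n\<close>, up to the normalization.
\<close>

lemma integral_draw_prob_scaled:
  assumes n: "1 \<le> n"
  shows "(LBINT t. indicator {0..} t * draw_prob n k (nat \<lfloor>t * sqrt (real n)\<rfloor>)) = draw_moment n k 0 / sqrt (real n)"
proof -
  define s where "s = sqrt (real n)"
  have s: "s > 0" using n by (simp add: s_def)
  have eq: "indicator {0..} t * draw_prob n k (nat \<lfloor>t * s\<rfloor>)
        = (\<Sum>j\<le>k. draw_prob n k j * indicator {real j / s..<real (Suc j) / s} t)" for t
  proof (cases "t \<ge> 0")
    case True
    have "t \<in> {real j / s..<real (Suc j) / s} \<longleftrightarrow> j = nat \<lfloor>t * s\<rfloor>" for j
    proof -
      have "t \<in> {real j / s..<real (Suc j) / s} \<longleftrightarrow> real j \<le> t * s \<and> t * s < real j + 1"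
        using s by (simp add: field_simps)
      also have "\<dots> \<longleftrightarrow> \<lfloor>t * s\<rfloor> = int j" by linarith
      also have "\<dots> \<longleftrightarrow> j = nat \<lfloor>t * s\<rfloor>" using True s by auto
      finally show ?thesis .
    qed
    then have "(\<Sum>j\<le>k. draw_prob n k j * indicator {real j / s..<real (Suc j) / s} t)
        = (\<Sum>j\<le>k. if j = nat \<lfloor>t * s\<rfloor> then draw_prob n k j else 0)"
      by (intro sum.cong refl) (simp add: indicator_def)
    also have "\<dots> = draw_prob n k (nat \<lfloor>t * s\<rfloor>)" by (simp add: draw_prob_eq_0)
    finally show ?thesis using True by simp
  next
    case False
    then have "t < real j / s" for j using s by (meson divide_nonneg_pos le_less_trans not_le of_nat_0_le_iff order_less_le_trans)
    then have "indicator {real j / s..<real (Suc j) / s} t = (0 :: real)" for j by (auto simp: not_le)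
    then show ?thesis using False by simp
  qed
  have le: "real j / s \<le> real (Suc j) / s" for j using s by (intro divide_right_mono) auto
  have int: "integrable lborel (indicator {real j / s..<real (Suc j) / s} :: real \<Rightarrow> real)" for j
    using le[of j] by (intro integrable_real_indicator) auto
  have "(LBINT t. indicator {0..} t * draw_prob n k (nat \<lfloor>t * s\<rfloor>))
    = (\<Sum>j\<le>k. draw_prob n k j * measure lborel {real j / s..<real (Suc j) / s})"
    unfolding eq by (subst Bochner_Integration.integral_sum) (use int in auto)
  also have "\<dots> = (\<Sum>j\<le>k. draw_prob n k j * (1 / s))"
    using le by (intro sum.cong refl) (simp add: measure_lborel_Ico diff_divide_distrib[symmetric])
  also have "\<dots> = draw_moment n k 0 / s" by (simp add: draw_moment_def sum_divide_distrib)
  finally show ?thesis by (simp add: s_def)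
qed

lemma draw_moment_0_tendsto:
  fixes k :: "nat \<Rightarrow> nat"
  assumes k: "\<And>n. k n \<le> n" and c: "(\<lambda>n. (real n - real (k n)) / sqrt (real n)) \<longlonglongrightarrow> c"
  shows "(\<lambda>n. draw_moment n (k n) 0 / sqrt (real n))
     \<longlonglongrightarrow> (LBINT t. indicator {0..} t * exp (- (c * t + t\<^sup>2 / 2)))"
proof -
  let ?G = "\<lambda>n t. indicator {0..} t * draw_prob n (k n) (nat \<lfloor>t * sqrt (real n)\<rfloor>)"
  \<comment> \<open>The index is shifted because the bound and the integral formula require \<open>n \<ge> 1\<close>.\<close>
  have "(\<lambda>n. LBINT t. ?G (Suc n) t) \<longlonglongrightarrow> (LBINT t. indicator {0..} t * exp (- (c * t + t\<^sup>2 / 2)))"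
  proof (rule integral_dominated_convergence)
    show "integrable lborel (\<lambda>t::real. exp 4 * (exp (- t) * indicator {0..} t))"
      using integrable_exp_minus_Ici by (rule integrable_mult_right)
    show "AE t in lborel. (\<lambda>n. ?G (Suc n) t) \<longlonglongrightarrow> indicator {0..} t * exp (- (c * t + t\<^sup>2 / 2))"
    proof (intro always_eventually allI)
      fix t :: real
      show "(\<lambda>n. ?G (Suc n) t) \<longlonglongrightarrow> indicator {0..} t * exp (- (c * t + t\<^sup>2 / 2))"
      proof (cases "t \<ge> 0")
        case True
        show ?thesis
          using LIMSEQ_Suc[OF draw_prob_tendsto[OF k c True]] True by simp
      qed simp
    qed
    show "AE t in lborel. norm (?G (Suc n) t) \<le> exp 4 * (exp (- t) * indicator {0..} t)" for n
    proof (intro always_eventually allI)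
      fix t :: real
      let ?j = "nat \<lfloor>t * sqrt (real (Suc n))\<rfloor>"
      have "0 \<le> draw_prob (Suc n) (k (Suc n)) ?j"
        using draw_prob_nonneg draw_prob_eq_0 by (metis le_less_linear order_refl)
      then show "norm (?G (Suc n) t) \<le> exp 4 * (exp (- t) * indicator {0..} t)"
        using draw_prob_scaled_dominated[OF _ k, of "Suc n" t] by (cases "t \<ge> 0") auto
    qed
    show "(\<lambda>t. ?G (Suc n) t) \<in> borel_measurable lborel" for n
    proof -
      have "(\<lambda>i. draw_prob (Suc n) (k (Suc n)) (nat i)) \<in> borel_measurable (count_space UNIV)" by simp
      from measurable_compose[OF _ this, of "\<lambda>t. \<lfloor>t * sqrt (real (Suc n))\<rfloor>" lborel]
      show ?thesis by measurable
    qed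
  qed measurable
  then have "(\<lambda>n. draw_moment (Suc n) (k (Suc n)) 0 / sqrt (real (Suc n)))
     \<longlonglongrightarrow> (LBINT t. indicator {0..} t * exp (- (c * t + t\<^sup>2 / 2)))"
    by (simp only: integral_draw_prob_scaled le_add1 plus_1_eq_Suc[symmetric])
  then show ?thesis by (rule LIMSEQ_imp_Suc)
qed

lemma gaussian_tail_shift:
  "(LBINT t. indicator {0..} t * exp (- (c * t + t\<^sup>2 / 2)))
     = exp (c\<^sup>2 / 2) * (LBINT t:{c..}. exp (- (t\<^sup>2 / 2)))" for c :: real
proof -
  have "(LBINT t:{c..}. exp (- (t\<^sup>2 / 2))) = (LBINT t. indicator {c..} (c + 1 * t) *\<^sub>R exp (- ((c + 1 * t)\<^sup>2 / 2)))"
    unfolding set_lebesgue_integral_def by (subst lborel_integral_real_affine[where c = 1 and t = c]) simp_all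
  also have "\<dots> = (LBINT t. exp (- (c\<^sup>2 / 2)) * (indicator {0..} t * exp (- (c * t + t\<^sup>2 / 2))))"
    by (intro Bochner_Integration.integral_cong refl)
      (auto simp: indicator_def power2_sum add_divide_distrib algebra_simps simp flip: exp_add)
  also have "\<dots> = exp (- (c\<^sup>2 / 2)) * (LBINT t. indicator {0..} t * exp (- (c * t + t\<^sup>2 / 2)))" by simp
  finally show ?thesis by (simp add: exp_minus field_simps)
qed

text \<open>
  Dropping the factor \<open>exp (- t\<^sup>2 / 2)\<close> strictly increases the integral, to \<open>1 / c\<close>. Hence the
  constant \<open>\<kappa>\<close> of the critical window is positive, as needed to turn the limit of \<open>E / n\<close> into an
  asymptotic equivalence.
\<close>

lemma gaussian_tail_bound:
  fixes c :: real
  assumes c: "c > 0"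
  shows "c * (LBINT t. indicator {0..} t * exp (- (c * t + t\<^sup>2 / 2))) < 1"
proof -
  let ?f = "\<lambda>t::real. indicator {0..} t * exp (- (c * t)) :: real"
  let ?g = "\<lambda>t::real. indicator {0..} t * exp (- (c * t + t\<^sup>2 / 2)) :: real"
  let ?e = "\<lambda>t::real. exp (- t) * indicator {0..} t :: real"
  have fe: "?e (0 + c * t) = ?f t" for t using c by (auto simp: indicator_def zero_le_mult_iff)
  have f: "integrable lborel ?f"
    using lborel_integrable_real_affine[OF integrable_exp_minus_Ici, of c 0] c unfolding fe by simp
  have "(LBINT t. ?e t) = 1"
    using has_bochner_integral_I0i_power_exp_m'[of 0] by (auto simp: has_bochner_integral_iff)
  then have F: "c * (LBINT t. ?f t) = 1"
    using lborel_integral_real_affine[of c ?e 0] c unfolding fe by simp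
  have g: "integrable lborel ?g"
    by (rule Bochner_Integration.integrable_bound[OF f]) (auto simp: indicator_def)
  have nonneg: "0 \<le> ?f t - ?g t" for t by (auto simp: indicator_def)
  have "(LBINT t. ?f t - ?g t) \<noteq> 0"
  proof
    assume "(LBINT t. ?f t - ?g t) = 0"
    then have "AE t in lborel. ?f t - ?g t = 0"
      using integral_nonneg_eq_0_iff_AE[of lborel "\<lambda>t. ?f t - ?g t"] f g nonneg by simp
    then have "AE t::real in lborel. t \<notin> {0<..<1}" by eventually_elim auto
    then have "{0<..<1::real} \<in> null_sets lborel" by (subst AE_iff_null_sets) auto
    then show False by (simp add: null_sets_def)
  qed
  moreover have "(LBINT t. ?f t - ?g t) \<ge> 0" using nonneg by simp
  ultimately have "(LBINT t. ?g t) < (LBINT t. ?f t)" using f g by simp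
  from mult_strict_left_mono[OF this c] show ?thesis unfolding F .
qed

lemma draw_moment_1_critical:
  fixes k :: "nat \<Rightarrow> nat"
  assumes k: "\<And>n. k n \<le> n" and c: "(\<lambda>n. (real n - real (k n)) / sqrt (real n)) \<longlonglongrightarrow> c"
  shows "(\<lambda>n. draw_moment n (k n) 1 / real n)
    \<longlonglongrightarrow> 1 - c * (LBINT t. indicator {0..} t * exp (- (c * t + t\<^sup>2 / 2)))"
proof -
  have "(\<lambda>n. 1 - (real n - real (k n)) / sqrt (real n) * (draw_moment n (k n) 0 / sqrt (real n)))
     \<longlonglongrightarrow> 1 - c * (LBINT t. indicator {0..} t * exp (- (c * t + t\<^sup>2 / 2)))"
    by (intro tendsto_intros c draw_moment_0_tendsto[OF k c])
  moreover have "eventually (\<lambda>n. draw_moment n (k n) 1 / real n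
      = 1 - (real n - real (k n)) / sqrt (real n) * (draw_moment n (k n) 0 / sqrt (real n))) sequentially"
    using eventually_ge_at_top[of 1]
  proof eventually_elim
    case (elim n)
    define D where "D = real n - real (k n)"
    have "draw_moment n (k n) 1 / real n = 1 - D * draw_moment n (k n) 0 / real n"
      unfolding draw_moment_1[OF elim k] D_def using elim by (simp add: diff_divide_distrib)
    then show ?case unfolding D_def[symmetric] by simp
  qed
  ultimately show ?thesis by (simp add: tendsto_cong)
qed

section \<open>The asymptotic regimes\<close>

lemma expected_root_cluster_moment:
  assumes "1 \<le> n" "k \<le> n"
  shows "expected_root_cluster n k = draw_moment n k 1"
proof -
  have "draw_moment n k 1 = (\<Sum>j\<in>{0..k}. real j * draw_prob n k j)"
    by (simp add: draw_moment_def atMost_atLeast0)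
  also have "\<dots> = (\<Sum>j=1..k. real j * draw_prob n k j)"
    by (simp add: sum.atLeast_Suc_atMost)
  finally show ?thesis by (simp add: expected_root_cluster_eq[OF assms] draw_prob_def)
qed

lemma expected_root_cluster_asymp_iff:
  assumes "\<And>n. k n \<le> n"
  shows "(\<lambda>n. expected_root_cluster n (k n)) \<sim>[sequentially] g
     \<longleftrightarrow> (\<lambda>n. draw_moment n (k n) 1) \<sim>[sequentially] g"
proof (rule asymp_equiv_cong)
  show "eventually (\<lambda>n. expected_root_cluster n (k n) = draw_moment n (k n) 1) sequentially"
    using eventually_ge_at_top[of 1]
    by (rule eventually_mono) (rule expected_root_cluster_moment[OF _ assms])
qed simp

lemma asymp_equiv_real_divide:
  assumes "f \<sim>[sequentially] (\<lambda>n. a * g n)" "\<forall>\<^sub>F n in sequentially. g n \<noteq> (0::real)"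
  shows "(\<lambda>n. f n / g n) \<longlonglongrightarrow> a"
proof -
  have "(\<lambda>n. f n / g n) \<sim>[sequentially] (\<lambda>n. a * g n / g n)"
    by (intro asymp_equiv_intros assms(1))
  also have "\<dots> \<sim>[sequentially] (\<lambda>_. a)"
    using eventually_mono[OF assms(2), of "\<lambda>n. a * g n / g n = a"] by (intro asymp_equiv_refl_ev) simp
  finally show ?thesis by (rule asymp_equivD_const)
qed

text \<open>
  The gap \<open>n - k\<close> is \<open>(1 - k / n) n\<close>, so that \<open>k n / (n - k)\<^sup>2\<close> is \<open>(k / n) / (1 - k / n)\<^sup>2\<close>. The
  choice \<open>\<alpha> = 0\<close> covers \<open>k = o(n)\<close>.
\<close>

lemma expected_root_cluster_linear_gap:
  fixes k :: "nat \<Rightarrow> nat"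
  assumes k: "\<And>n. k n \<le> n" and lim: "(\<lambda>n. real (k n) / real n) \<longlonglongrightarrow> \<alpha>" and \<alpha>: "\<alpha> < 1"
  shows "(\<lambda>n. expected_root_cluster n (k n)) \<sim>[sequentially] (\<lambda>n. real (k n) / real n / (1 - \<alpha>)\<^sup>2)"
proof -
  let ?x = "\<lambda>n. real (k n) / real n"
  have pos: "eventually (\<lambda>n::nat. n > 0) sequentially" by (rule eventually_gt_at_top)
  have "eventually (\<lambda>n. ?x n < 1) sequentially" using lim \<alpha> by (rule order_tendstoD)
  then have lt: "eventually (\<lambda>n. k n < n) sequentially"
    using pos by eventually_elim (simp add: field_simps)
  have sq: "real n - real (k n) = real n * (1 - ?x n)" if "n > 0" for n
    using that by (simp add: field_simps)
  have "(\<lambda>n. 1 / real n * (1 / (1 - ?x n)\<^sup>2)) \<longlonglongrightarrow> 0 * (1 / (1 - \<alpha>)\<^sup>2)"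
    using \<alpha> by (intro tendsto_intros lim lim_1_over_n) auto
  moreover have "eventually (\<lambda>n. 1 / real n * (1 / (1 - ?x n)\<^sup>2) = real n / (real n - real (k n))\<^sup>2) sequentially"
    using pos by eventually_elim (simp only: sq, simp add: power2_eq_square)
  ultimately have "(\<lambda>n. real n / (real n - real (k n))\<^sup>2) \<longlonglongrightarrow> 0" by (simp add: tendsto_cong)
  from draw_moment_1_asymp[OF k this lt]
  have "(\<lambda>n. expected_root_cluster n (k n)) \<sim>[sequentially] (\<lambda>n. real (k n) * real n / (real n - real (k n))\<^sup>2)"
    by (simp add: expected_root_cluster_asymp_iff k)
  also have "\<dots> \<sim>[sequentially] (\<lambda>n. ?x n / (1 - ?x n)\<^sup>2)"
    using pos by (intro asymp_equiv_refl_ev) (auto elim!: eventually_mono simp only: sq, simp add: power2_eq_square)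
  also have "\<dots> \<sim>[sequentially] (\<lambda>n. ?x n / (1 - \<alpha>)\<^sup>2)"
    using \<alpha> by (intro asymp_equiv_intros tendsto_imp_asymp_equiv_const tendsto_intros lim) auto
  finally show ?thesis .
qed

lemma expected_root_cluster_large_gap:
  fixes d :: "nat \<Rightarrow> nat"
  assumes d: "\<And>n. d n \<le> n" and large: "(\<lambda>n. real (d n)) \<in> \<omega>(\<lambda>n. sqrt (real n))"
    and small: "(\<lambda>n. real (d n)) \<in> o(\<lambda>n. real n)"
  shows "(\<lambda>n. expected_root_cluster n (n - d n)) \<sim>[sequentially] (\<lambda>n. (real n)\<^sup>2 / (real (d n))\<^sup>2)"
proof -
  have pos: "eventually (\<lambda>n::nat. n > 0) sequentially" by (rule eventually_gt_at_top)
  have "(\<lambda>n. sqrt (real n)) \<in> o(\<lambda>n. real (d n))" using large by (simp add: smallomega_iff_smallo)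
  then have q: "(\<lambda>n. sqrt (real n) / real (d n)) \<longlonglongrightarrow> 0" by (rule smalloD_tendsto)
  have "(\<lambda>n. (sqrt (real n) / real (d n))\<^sup>2) \<longlonglongrightarrow> 0\<^sup>2" by (intro tendsto_intros q)
  then have eps: "(\<lambda>n. real n / (real n - real (n - d n))\<^sup>2) \<longlonglongrightarrow> 0"
    by (simp add: of_nat_diff d power_divide)
  have "eventually (\<lambda>n. norm (real (d n)) \<ge> 1 * norm (sqrt (real n))) sequentially"
    using large by (rule landau_omega.smallD) simp
  then have lt: "eventually (\<lambda>n. n - d n < n) sequentially"
    using pos by eventually_elim (auto simp: intro!: diff_less Nat.gr0I)
  have "(\<lambda>n. real (d n) / real n) \<longlonglongrightarrow> 0" using small by (rule smalloD_tendsto)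
  from tendsto_diff[OF tendsto_const[of 1] this]
  have one: "(\<lambda>n. 1 - real (d n) / real n) \<longlonglongrightarrow> 1" by simp
  have "(\<lambda>n. expected_root_cluster n (n - d n)) \<sim>[sequentially]
      (\<lambda>n. real (n - d n) * real n / (real n - real (n - d n))\<^sup>2)"
    using draw_moment_1_asymp[OF _ eps lt] by (subst expected_root_cluster_asymp_iff) auto
  also have "\<dots> \<sim>[sequentially] (\<lambda>n. (1 - real (d n) / real n) * ((real n)\<^sup>2 / (real (d n))\<^sup>2))"
    using pos by (intro asymp_equiv_refl_ev)
      (auto elim!: eventually_mono simp: of_nat_diff d field_simps power2_eq_square)
  also have "\<dots> \<sim>[sequentially] (\<lambda>n. 1 * ((real n)\<^sup>2 / (real (d n))\<^sup>2))"
    by (intro asymp_equiv_intros tendsto_imp_asymp_equiv_const one) simp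
  finally show ?thesis by simp
qed

lemma expected_root_cluster_critical_gap:
  fixes d :: "nat \<Rightarrow> nat"
  assumes d: "\<And>n. d n \<le> n" and c: "c > 0" and lim: "(\<lambda>n. real (d n) / sqrt (real n)) \<longlonglongrightarrow> c"
  shows "(\<lambda>n. expected_root_cluster n (n - d n)) \<sim>[sequentially]
     (\<lambda>n. (1 - c * exp (c\<^sup>2 / 2) * (LBINT t:{c..}. exp (- (t\<^sup>2 / 2)))) * real n)"
    (is "_ \<sim>[sequentially] (\<lambda>n. ?\<kappa> * real n)")
proof -
  let ?I = "LBINT t. indicator {0..} t * exp (- (c * t + t\<^sup>2 / 2))"
  have \<kappa>: "1 - c * ?I = ?\<kappa>" by (simp only: gaussian_tail_shift mult.assoc)
  have "(\<lambda>n. draw_moment n (n - d n) 1 / real n) \<longlonglongrightarrow> 1 - c * ?I"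
    using lim d by (intro draw_moment_1_critical) (simp_all add: of_nat_diff)
  then have "(\<lambda>n. draw_moment n (n - d n) 1) \<sim>[sequentially] (\<lambda>n. (1 - c * ?I) * real n)"
    using gaussian_tail_bound[OF c] by (intro asymp_equivI'_const) auto
  then show ?thesis unfolding \<kappa> by (subst expected_root_cluster_asymp_iff) auto
qed

text \<open>
  Both sides are asymptotic to \<open>n\<close>: the left-hand side by the limit of the critical window at
  \<open>c = 0\<close>, the right-hand side because \<open>d sqrt n = o(n)\<close>.
\<close>

lemma expected_root_cluster_small_gap:
  fixes d :: "nat \<Rightarrow> nat"
  assumes d: "\<And>n. d n \<le> n" and small: "(\<lambda>n. real (d n)) \<in> o(\<lambda>n. sqrt (real n))"
  shows "(\<lambda>n. expected_root_cluster n (n - d n)) \<sim>[sequentially] (\<lambda>n. real n - b * real (d n) * sqrt (real n))"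
proof -
  have pos: "eventually (\<lambda>n::nat. n > 0) sequentially" by (rule eventually_gt_at_top)
  have v: "(\<lambda>n. real (d n) / sqrt (real n)) \<longlonglongrightarrow> 0" using small by (rule smalloD_tendsto)
  have lim: "(\<lambda>n. (real n - real (n - d n)) / sqrt (real n)) \<longlonglongrightarrow> 0"
    using v d by (simp add: of_nat_diff)
  have "(\<lambda>n. draw_moment n (n - d n) 1 / real n) \<longlonglongrightarrow> 1"
    using draw_moment_1_critical[OF _ lim] by simp
  then have "(\<lambda>n. draw_moment n (n - d n) 1) \<sim>[sequentially] (\<lambda>n. 1 * real n)"
    by (intro asymp_equivI'_const) auto
  moreover have "(\<lambda>n. real n - b * real (d n) * sqrt (real n)) \<sim>[sequentially] (\<lambda>n. 1 * real n)"
  proof (rule asymp_equivI'_const)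
    have "(\<lambda>n. 1 - b * (real (d n) / sqrt (real n))) \<longlonglongrightarrow> 1 - b * 0" by (intro tendsto_intros v)
    moreover have "eventually (\<lambda>n. 1 - b * (real (d n) / sqrt (real n))
        = (real n - b * real (d n) * sqrt (real n)) / real n) sequentially"
      using pos
    proof eventually_elim
      case (elim n)
      define s where "s = sqrt (real n)"
      have "s \<noteq> 0" "real n = s * s" using elim by (simp_all add: s_def)
      then show ?case unfolding s_def[symmetric] by (simp add: field_simps)
    qed
    ultimately show "(\<lambda>n. (real n - b * real (d n) * sqrt (real n)) / real n) \<longlonglongrightarrow> 1"
      by (simp add: tendsto_cong)
  qed simp
  ultimately have "(\<lambda>n. draw_moment n (n - d n) 1) \<sim>[sequentially] (\<lambda>n. real n - b * real (d n) * sqrt (real n))"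
    using asymp_equiv_trans asymp_equiv_symI by blast
  then show ?thesis by (subst expected_root_cluster_asymp_iff) auto
qed

theorem theorem7:
  shows "(\<forall>n k :: nat. 1 \<le> n \<and> k \<le> n \<longrightarrow>
            expected_root_cluster n k
              = (\<Sum>j=1..k. real j * falling_factorial (real k) j / real n ^ j))
       \<and> (\<forall>k :: nat \<Rightarrow> nat. (\<forall>n. k n \<le> n) \<and> (\<lambda>n. real (k n)) \<in> o(\<lambda>n. real n) \<longrightarrow>
            (\<lambda>n. expected_root_cluster n (k n)) \<sim>[sequentially] (\<lambda>n. real (k n) / real n))
       \<and> (\<forall>(k :: nat \<Rightarrow> nat) (\<alpha> :: real). (\<forall>n. k n \<le> n) \<and> 0 < \<alpha> \<and> \<alpha> < 1 \<and>
            (\<lambda>n. real (k n)) \<sim>[sequentially] (\<lambda>n. \<alpha> * real n) \<longrightarrow>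
            (\<lambda>n. expected_root_cluster n (k n)) \<sim>[sequentially] (\<lambda>n. \<alpha> / (1 - \<alpha>)\<^sup>2))
       \<and> (\<forall>d :: nat \<Rightarrow> nat. (\<forall>n. d n \<le> n) \<and>
            (\<lambda>n. real (d n)) \<in> \<omega>(\<lambda>n. sqrt (real n)) \<and> (\<lambda>n. real (d n)) \<in> o(\<lambda>n. real n) \<longrightarrow>
            (\<lambda>n. expected_root_cluster n (n - d n))
              \<sim>[sequentially] (\<lambda>n. (real n)\<^sup>2 / (real (d n))\<^sup>2))
       \<and> (\<forall>(d :: nat \<Rightarrow> nat) (c :: real). (\<forall>n. d n \<le> n) \<and> c > 0 \<and>
            (\<lambda>n. real (d n)) \<sim>[sequentially] (\<lambda>n. c * sqrt (real n)) \<longrightarrow>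
            (\<lambda>n. expected_root_cluster n (n - d n))
              \<sim>[sequentially]
                (\<lambda>n. (1 - c * exp (c\<^sup>2 / 2) * (LBINT t:{c..}. exp (- (t\<^sup>2 / 2)))) * real n))
       \<and> (\<forall>d :: nat \<Rightarrow> nat. (\<forall>n. d n \<le> n) \<and> (\<lambda>n. real (d n)) \<in> o(\<lambda>n. sqrt (real n)) \<longrightarrow>
            (\<lambda>n. expected_root_cluster n (n - d n))
              \<sim>[sequentially] (\<lambda>n. real n - sqrt (pi / 2) * real (d n) * sqrt (real n)))"
proof (intro conjI allI impI, goal_cases)
  case (1 n k)
  then show ?case using expected_root_cluster_eq by simp
next
  case (2 k)
  then have "(\<lambda>n. real (k n) / real n) \<longlonglongrightarrow> 0" using smalloD_tendsto by blast
  then show ?case using expected_root_cluster_linear_gap[of k 0] 2 by simp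
next
  case (3 k \<alpha>)
  then have k: "\<And>n. k n \<le> n" and \<alpha>: "0 < \<alpha>" "\<alpha> < 1"
    and asymp: "(\<lambda>n. real (k n)) \<sim>[sequentially] (\<lambda>n. \<alpha> * real n)" by auto
  have lim: "(\<lambda>n. real (k n) / real n) \<longlonglongrightarrow> \<alpha>"
    using asymp eventually_gt_at_top[of 0]
    by (intro asymp_equiv_real_divide) (auto elim!: eventually_mono)
  have "(\<lambda>n. expected_root_cluster n (k n)) \<sim>[sequentially] (\<lambda>n. real (k n) / real n / (1 - \<alpha>)\<^sup>2)"
    by (rule expected_root_cluster_linear_gap[OF k lim \<alpha>(2)])
  also have "\<dots> \<sim>[sequentially] (\<lambda>n. \<alpha> / (1 - \<alpha>)\<^sup>2)"
    using \<alpha> by (intro tendsto_imp_asymp_equiv_const tendsto_intros lim) auto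
  finally show ?case .
next
  case (4 d)
  then show ?case using expected_root_cluster_large_gap by blast
next
  case (5 d c)
  then have "(\<lambda>n. real (d n) / sqrt (real n)) \<longlonglongrightarrow> c"
    using eventually_gt_at_top[of 0]
    by (intro asymp_equiv_real_divide) (auto elim!: eventually_mono)
  then show ?case using expected_root_cluster_critical_gap 5 by blast
next
  case (6 d)
  then show ?case using expected_root_cluster_small_gap by blast
qed

end
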